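(* Let $R$ be a commutative $\mathbf{Q}$-algebra and let $\mathfrak{g}=\bigoplus_{n\ge 0}\mathfrak{g}_n$ be a Lie algebra over $R$ graded in the set $\mathbf{N}$ of non-negative integers. Then the reduced Koszul map of $\mathfrak{g}$ coincides with the reduced Koszul map of $\mathfrak{g}_0$; that is, $\bar\eta_{\mathfrak{g}}$ vanishes on $H_3(\mathfrak{g})_n$ for all $n\neq 0$, and in degree $0$, under the identifications $H_3(\mathfrak{g})_0=H_3(\mathfrak{g}_0)$ and $\mathrm{Kill}(\mathfrak{g})_0=\mathrm{Kill}(\mathfrak{g}_0)$ induced by the inclusion $\mathfrak{g}_0\subset\mathfrak{g}$, it equals $\bar\eta_{\mathfrak{g}_0}$.
   Context: Tensor, exterior and symmetric powers are over the commutative ground ring $R$. $H_*(\mathfrak{g})$ is the homology of the Chevalley–Eilenberg complex $\Lambda^*\mathfrak{g}$ with $\partial_n(x_1\wedge\dots\wedge x_n)=\sum_{i<j}(-1)^{i+j}[x_i,x_j]\wedge x_1\wedge\dots\wedge\hat{x_i}\wedge\dots\wedge\hat{x_j}\wedge\dots\wedge x_n$, and $Z_3(\mathfrak{g})=\ker\partial_3$. Writing $x\odot y$ for the product in the symmetric square $S^2\mathfrak{g}$, the Killing module $\mathrm{Kill}(\mathfrak{g})$ is the cokernel of $\mathfrak{g}^{\otimes 3}\to S^2\mathfrak{g}$, $x\otimes y\otimes z\mapsto [x,y]\odot z-x\odot[y,z]$. The Koszul map $\eta=\eta_{\mathfrak g}:\Lambda^3\mathfrak{g}\to\mathrm{Kill}(\mathfrak{g})$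 sends $x\wedge y\wedge z$ to the class of $x\odot[y,z]$; it vanishes on 3-boundaries, and the reduced Koszul map $\bar\eta=\bar\eta_{\mathfrak g}:H_3(\mathfrak{g})\to\mathrm{Kill}(\mathfrak{g})$ is induced by restricting $\eta$ to $Z_3(\mathfrak{g})$. A grading of $\mathfrak{g}$ (with $[\mathfrak{g}_m,\mathfrak{g}_n]\subset\mathfrak{g}_{m+n}$) induces gradings on $\Lambda^3\mathfrak{g}$, $S^2\mathfrak{g}$ (degrees add), hence on $H_3(\mathfrak{g})$ and $\mathrm{Kill}(\mathfrak{g})$, preserved by $\bar\eta$. *)

theory Defs
  imports "HOL-Algebra.Module" "HOL-Algebra.AbelCoset" "HOL-Algebra.Algebraic_Closure_Type"
begin

section \<open>Modules: homomorphisms, spans, quotients, free modules\<close>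

text \<open>
  The records of \<^theory>\<open>HOL-Algebra.Module\<close> extend rings; the fields \<^const>\<open>monoid.mult\<close> and \<^const>\<open>one\<close> of
  a module carry no information and are left undefined in the constructions below.
\<close>

definition module_hom ::
  "('a, 'r) ring_scheme \<Rightarrow> ('a, 'b, 'm) module_scheme \<Rightarrow> ('a, 'c, 'n) module_scheme \<Rightarrow> ('b \<Rightarrow> 'c) set"
  where "module_hom R M N = {f \<in> carrier M \<rightarrow> carrier N.
    (\<forall>x\<in>carrier M. \<forall>y\<in>carrier M. f (x \<oplus>\<^bsub>M\<^esub> y) = f x \<oplus>\<^bsub>N\<^esub> f y) \<and>
    (\<forall>a\<in>carrier R. \<forall>x\<in>carrier M. f (a \<odot>\<^bsub>M\<^esub> x) = a \<odot>\<^bsub>N\<^esub> f x)}"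

definition module_iso ::
  "('a, 'r) ring_scheme \<Rightarrow> ('a, 'b, 'm) module_scheme \<Rightarrow> ('a, 'c, 'n) module_scheme \<Rightarrow> ('b \<Rightarrow> 'c) set"
  where "module_iso R M N = {f \<in> module_hom R M N. bij_betw f (carrier M) (carrier N)}"

definition module_span ::
  "('a, 'r) ring_scheme \<Rightarrow> ('a, 'b, 'm) module_scheme \<Rightarrow> 'b set \<Rightarrow> 'b set"
  where "module_span R M S = \<Inter>{N. submodule N R M \<and> S \<subseteq> N}"

definition quotient_module ::
  "('a, 'b, 'm) module_scheme \<Rightarrow> 'b set \<Rightarrow> ('a, 'b set) module"
  where "quotient_module M N =
    \<lparr>carrier = a_rcosets\<^bsub>M\<^esub> N, monoid.mult = undefined, one = undefined, zero = N, add = set_add M,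
     module.smult = (\<lambda>a C. \<Union>x\<in>C. N +>\<^bsub>M\<^esub> (a \<odot>\<^bsub>M\<^esub> x))\<rparr>"

text \<open>The map on cosets induced by a map \<open>f\<close> that is constant on each of them.\<close>

definition induced :: "('b \<Rightarrow> 'c) \<Rightarrow> 'b set \<Rightarrow> 'c"
  where "induced f C = the_elem (f ` C)"

definition free_module :: "('a, 'r) ring_scheme \<Rightarrow> 'x set \<Rightarrow> ('a, 'x \<Rightarrow> 'a) module"
  where "free_module R S =
    \<lparr>carrier = {p. (\<forall>x\<in>S. p x \<in> carrier R) \<and> (\<forall>x. x \<notin> S \<longrightarrow> p x = \<zero>\<^bsub>R\<^esub>) \<and> finite {x. p x \<noteq> \<zero>\<^bsub>R\<^esub>}},
     monoid.mult = undefined, one = undefined,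
     zero = (\<lambda>x. \<zero>\<^bsub>R\<^esub>), add = (\<lambda>p q x. p x \<oplus>\<^bsub>R\<^esub> q x), module.smult = (\<lambda>a p x. a \<otimes>\<^bsub>R\<^esub> p x)\<rparr>"

definition free_gen :: "('a, 'r) ring_scheme \<Rightarrow> 'x \<Rightarrow> 'x \<Rightarrow> 'a"
  where "free_gen R x = (\<lambda>y. if y = x then \<one>\<^bsub>R\<^esub> else \<zero>\<^bsub>R\<^esub>)"

definition free_lift ::
  "('a, 'r) ring_scheme \<Rightarrow> ('a, 'c, 'n) module_scheme \<Rightarrow> ('x \<Rightarrow> 'c) \<Rightarrow> ('x \<Rightarrow> 'a) \<Rightarrow> 'c"
  where "free_lift R N \<phi> p = (\<Oplus>\<^bsub>N\<^esub>x\<in>{x. p x \<noteq> \<zero>\<^bsub>R\<^esub>}. p x \<odot>\<^bsub>N\<^esub> \<phi> x)"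


section \<open>Tensor, exterior and symmetric powers\<close>

text \<open>
  The tensor power is the free module on \<open>n\<close>-tuples (lists of length \<open>n\<close>) modulo multilinearity;
  exterior powers and the symmetric square are quotients of tensor powers. Each comes with
  its pure elements and with the linear map \<open>\<dots>_lift\<close> out of it that takes a prescribed value
  \<open>\<phi> xs\<close> on the pure element given by \<open>xs\<close> (for \<open>\<phi>\<close> multilinear, and respectively alternating or
  symmetric).
\<close>

definition tuples :: "('b, 'm) ring_scheme \<Rightarrow> nat \<Rightarrow> 'b list set"
  where "tuples M n = {xs. length xs = n \<and> set xs \<subseteq> carrier M}"

definition multilinear_rels ::
  "('a, 'r) ring_scheme \<Rightarrow> ('a, 'b, 'm) module_scheme \<Rightarrow> nat \<Rightarrow> ('b list \<Rightarrow> 'a) set"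
  where "multilinear_rels R M n =
    (let F = free_module R (tuples M n) in
      {free_gen R (xs[i := x \<oplus>\<^bsub>M\<^esub> y]) \<ominus>\<^bsub>F\<^esub> (free_gen R (xs[i := x]) \<oplus>\<^bsub>F\<^esub> free_gen R (xs[i := y]))
        | xs i x y. xs \<in> tuples M n \<and> i < n \<and> x \<in> carrier M \<and> y \<in> carrier M} \<union>
      {free_gen R (xs[i := a \<odot>\<^bsub>M\<^esub> x]) \<ominus>\<^bsub>F\<^esub> (a \<odot>\<^bsub>F\<^esub> free_gen R (xs[i := x]))
        | xs i a x. xs \<in> tuples M n \<and> i < n \<and> a \<in> carrier R \<and> x \<in> carrier M})"

definition tensor_null ::
  "('a, 'r) ring_scheme \<Rightarrow> ('a, 'b, 'm) module_scheme \<Rightarrow> nat \<Rightarrow> ('b list \<Rightarrow> 'a) set"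
  where "tensor_null R M n = module_span R (free_module R (tuples M n)) (multilinear_rels R M n)"

definition tensor_power ::
  "('a, 'r) ring_scheme \<Rightarrow> ('a, 'b, 'm) module_scheme \<Rightarrow> nat \<Rightarrow> ('a, ('b list \<Rightarrow> 'a) set) module"
  where "tensor_power R M n = quotient_module (free_module R (tuples M n)) (tensor_null R M n)"

definition tensor ::
  "('a, 'r) ring_scheme \<Rightarrow> ('a, 'b, 'm) module_scheme \<Rightarrow> 'b list \<Rightarrow> ('b list \<Rightarrow> 'a) set"
  where "tensor R M xs =
    tensor_null R M (length xs) +>\<^bsub>free_module R (tuples M (length xs))\<^esub> free_gen R xs"

definition tensor_lift ::
  "('a, 'r) ring_scheme \<Rightarrow> ('a, 'c, 'n) module_scheme \<Rightarrow> ('b list \<Rightarrow> 'c) \<Rightarrow> ('b list \<Rightarrow> 'a) set \<Rightarrow> 'c"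
  where "tensor_lift R N \<phi> = induced (free_lift R N \<phi>)"

definition ext_null ::
  "('a, 'r) ring_scheme \<Rightarrow> ('a, 'b, 'm) module_scheme \<Rightarrow> nat \<Rightarrow> ('b list \<Rightarrow> 'a) set set"
  where "ext_null R M n = module_span R (tensor_power R M n)
    {tensor R M xs | xs. xs \<in> tuples M n \<and> (\<exists>i j. i < j \<and> j < n \<and> xs ! i = xs ! j)}"

definition ext_power ::
  "('a, 'r) ring_scheme \<Rightarrow> ('a, 'b, 'm) module_scheme \<Rightarrow> nat \<Rightarrow> ('a, ('b list \<Rightarrow> 'a) set set) module"
  where "ext_power R M n = quotient_module (tensor_power R M n) (ext_null R M n)"

definition wedge ::
  "('a, 'r) ring_scheme \<Rightarrow> ('a, 'b, 'm) module_scheme \<Rightarrow> 'b list \<Rightarrow> ('b list \<Rightarrow> 'a) set set"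
  where "wedge R M xs = ext_null R M (length xs) +>\<^bsub>tensor_power R M (length xs)\<^esub> tensor R M xs"

definition ext_lift ::
  "('a, 'r) ring_scheme \<Rightarrow> ('a, 'c, 'n) module_scheme \<Rightarrow> ('b list \<Rightarrow> 'c) \<Rightarrow> ('b list \<Rightarrow> 'a) set set \<Rightarrow> 'c"
  where "ext_lift R N \<phi> = induced (tensor_lift R N \<phi>)"

definition ext_power_map ::
  "('a, 'r) ring_scheme \<Rightarrow> ('a, 'c, 'n) module_scheme \<Rightarrow> nat \<Rightarrow> ('b \<Rightarrow> 'c) \<Rightarrow>
    ('b list \<Rightarrow> 'a) set set \<Rightarrow> ('c list \<Rightarrow> 'a) set set"
  where "ext_power_map R N n f = ext_lift R (ext_power R N n) (\<lambda>xs. wedge R N (map f xs))"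

definition sym_null ::
  "('a, 'r) ring_scheme \<Rightarrow> ('a, 'b, 'm) module_scheme \<Rightarrow> ('b list \<Rightarrow> 'a) set set"
  where "sym_null R M = module_span R (tensor_power R M 2)
    {tensor R M [x, y] \<ominus>\<^bsub>tensor_power R M 2\<^esub> tensor R M [y, x] | x y. x \<in> carrier M \<and> y \<in> carrier M}"

definition sym_square ::
  "('a, 'r) ring_scheme \<Rightarrow> ('a, 'b, 'm) module_scheme \<Rightarrow> ('a, ('b list \<Rightarrow> 'a) set set) module"
  where "sym_square R M = quotient_module (tensor_power R M 2) (sym_null R M)"

definition sym_prod ::
  "('a, 'r) ring_scheme \<Rightarrow> ('a, 'b, 'm) module_scheme \<Rightarrow> 'b \<Rightarrow> 'b \<Rightarrow> ('b list \<Rightarrow> 'a) set set"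
  where "sym_prod R M x y = sym_null R M +>\<^bsub>tensor_power R M 2\<^esub> tensor R M [x, y]"

definition sym_lift ::
  "('a, 'r) ring_scheme \<Rightarrow> ('a, 'c, 'n) module_scheme \<Rightarrow> ('b list \<Rightarrow> 'c) \<Rightarrow> ('b list \<Rightarrow> 'a) set set \<Rightarrow> 'c"
  where "sym_lift R N \<phi> = induced (tensor_lift R N \<phi>)"

definition sym_square_map ::
  "('a, 'r) ring_scheme \<Rightarrow> ('a, 'c, 'n) module_scheme \<Rightarrow> ('b \<Rightarrow> 'c) \<Rightarrow>
    ('b list \<Rightarrow> 'a) set set \<Rightarrow> ('c list \<Rightarrow> 'a) set set"
  where "sym_square_map R N f =
    sym_lift R (sym_square R N) (\<lambda>xs. sym_prod R N (f (xs ! 0)) (f (xs ! 1)))"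


section \<open>Lie algebras\<close>

record ('a, 'b) lie = "('a, 'b) module" +
  bracket :: "'b \<Rightarrow> 'b \<Rightarrow> 'b"

locale lie_algebra = module R L
  for R :: "('a, 'r) ring_scheme" and L :: "('a, 'b, 'm) lie_scheme" (structure) +
  assumes bracket_closed:
      "\<lbrakk>x \<in> carrier L; y \<in> carrier L\<rbrakk> \<Longrightarrow> bracket L x y \<in> carrier L"
    and bracket_add_left:
      "\<lbrakk>x \<in> carrier L; y \<in> carrier L; z \<in> carrier L\<rbrakk>
        \<Longrightarrow> bracket L (x \<oplus>\<^bsub>L\<^esub> y) z = bracket L x z \<oplus>\<^bsub>L\<^esub> bracket L y z"
    and bracket_add_right:
      "\<lbrakk>x \<in> carrier L; y \<in> carrier L; z \<in> carrier L\<rbrakk>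
        \<Longrightarrow> bracket L x (y \<oplus>\<^bsub>L\<^esub> z) = bracket L x y \<oplus>\<^bsub>L\<^esub> bracket L x z"
    and bracket_smult_left:
      "\<lbrakk>a \<in> carrier R; x \<in> carrier L; y \<in> carrier L\<rbrakk>
        \<Longrightarrow> bracket L (a \<odot>\<^bsub>L\<^esub> x) y = a \<odot>\<^bsub>L\<^esub> bracket L x y"
    and bracket_smult_right:
      "\<lbrakk>a \<in> carrier R; x \<in> carrier L; y \<in> carrier L\<rbrakk>
        \<Longrightarrow> bracket L x (a \<odot>\<^bsub>L\<^esub> y) = a \<odot>\<^bsub>L\<^esub> bracket L x y"
    and bracket_self: "x \<in> carrier L \<Longrightarrow> bracket L x x = \<zero>\<^bsub>L\<^esub>"
    and jacobi:
      "\<lbrakk>x \<in> carrier L; y \<in> carrier L; z \<in> carrier L\<rbrakk>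
        \<Longrightarrow> bracket L x (bracket L y z) \<oplus>\<^bsub>L\<^esub> bracket L y (bracket L z x)
              \<oplus>\<^bsub>L\<^esub> bracket L z (bracket L x y) = \<zero>\<^bsub>L\<^esub>"

definition direct_sum_decomposition ::
  "('a, 'r) ring_scheme \<Rightarrow> ('a, 'b, 'm) module_scheme \<Rightarrow> ('i \<Rightarrow> 'b set) \<Rightarrow> bool"
  where "direct_sum_decomposition R M G \<longleftrightarrow>
    (\<forall>i. submodule (G i) R M) \<and>
    (\<forall>x\<in>carrier M. \<exists>!c. (\<forall>i. c i \<in> G i) \<and> finite {i. c i \<noteq> \<zero>\<^bsub>M\<^esub>} \<and>
        x = (\<Oplus>\<^bsub>M\<^esub>i\<in>{i. c i \<noteq> \<zero>\<^bsub>M\<^esub>}. c i))"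

locale graded_lie_algebra = lie_algebra R L
  for R :: "('a, 'r) ring_scheme" and L :: "('a, 'b, 'm) lie_scheme" (structure) +
  fixes G :: "nat \<Rightarrow> 'b set"
  assumes grading: "direct_sum_decomposition R L G"
    and bracket_graded: "\<lbrakk>x \<in> G m; y \<in> G n\<rbrakk> \<Longrightarrow> bracket L x y \<in> G (m + n)"


section \<open>Chevalley--Eilenberg homology\<close>

text \<open>
  Positions in lists are numbered from \<open>0\<close>; this does not affect the sign \<open>(-1)\<^sup>i\<^sup>+\<^sup>j\<close>.
  The lift starts at \<open>ext_power R L n\<close> and ends in \<open>ext_power R L (n - 1)\<close>; for \<open>n \<le> 1\<close> it is zero.
\<close>

definition ce_boundary ::
  "('a, 'r) ring_scheme \<Rightarrow> ('a, 'b, 'm) lie_scheme \<Rightarrow> nat \<Rightarrow> ('b list \<Rightarrow> 'a) set set \<Rightarrow> ('b list \<Rightarrow> 'a) set set"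
  where "ce_boundary R L n =
    (let E = ext_power R L (n - 1) in
      ext_lift R E (\<lambda>xs. finsum E
        (\<lambda>(i, j). ((\<ominus>\<^bsub>R\<^esub> \<one>\<^bsub>R\<^esub>) [^]\<^bsub>R\<^esub> (i + j)) \<odot>\<^bsub>E\<^esub>
          wedge R L (bracket L (xs ! i) (xs ! j) # nths xs (- {i, j})))
        {(i, j). i < j \<and> j < n}))"

definition ce_cycles ::
  "('a, 'r) ring_scheme \<Rightarrow> ('a, 'b, 'm) lie_scheme \<Rightarrow> nat \<Rightarrow> ('b list \<Rightarrow> 'a) set set set"
  where "ce_cycles R L n =
    a_kernel (ext_power R L n) (ext_power R L (n - 1)) (ce_boundary R L n)"

definition ce_boundaries ::
  "('a, 'r) ring_scheme \<Rightarrow> ('a, 'b, 'm) lie_scheme \<Rightarrow> nat \<Rightarrow> ('b list \<Rightarrow> 'a) set set set"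
  where "ce_boundaries R L n = ce_boundary R L (n + 1) ` carrier (ext_power R L (n + 1))"

definition ce_homology ::
  "('a, 'r) ring_scheme \<Rightarrow> ('a, 'b, 'm) lie_scheme \<Rightarrow> nat \<Rightarrow> ('a, ('b list \<Rightarrow> 'a) set set set) module"
  where "ce_homology R L n =
    quotient_module ((ext_power R L n)\<lparr>carrier := ce_cycles R L n\<rparr>) (ce_boundaries R L n)"

definition homology_class ::
  "('a, 'r) ring_scheme \<Rightarrow> ('a, 'b, 'm) lie_scheme \<Rightarrow> nat \<Rightarrow> ('b list \<Rightarrow> 'a) set set \<Rightarrow> ('b list \<Rightarrow> 'a) set set set"
  where "homology_class R L n z = ce_boundaries R L n +>\<^bsub>ext_power R L n\<^esub> z"

text \<open>The map \<open>H\<^sub>n(L) \<rightarrow> H\<^sub>n(L')\<close> induced by a homomorphism \<open>f\<close> of Lie algebras from \<open>L\<close> to \<open>L'\<close>.\<close>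

definition ce_homology_map ::
  "('a, 'r) ring_scheme \<Rightarrow> ('a, 'c, 'n) lie_scheme \<Rightarrow> nat \<Rightarrow> ('b \<Rightarrow> 'c) \<Rightarrow>
    ('b list \<Rightarrow> 'a) set set set \<Rightarrow> ('c list \<Rightarrow> 'a) set set set"
  where "ce_homology_map R L' n f =
    induced (\<lambda>z. homology_class R L' n (ext_power_map R L' n f z))"


section \<open>The Killing module and the Koszul map\<close>

definition kill_null ::
  "('a, 'r) ring_scheme \<Rightarrow> ('a, 'b, 'm) lie_scheme \<Rightarrow> ('b list \<Rightarrow> 'a) set set set"
  where "kill_null R L =
    tensor_lift R (sym_square R L)
      (\<lambda>xs. sym_prod R L (bracket L (xs ! 0) (xs ! 1)) (xs ! 2) \<ominus>\<^bsub>sym_square R L\<^esub>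
            sym_prod R L (xs ! 0) (bracket L (xs ! 1) (xs ! 2)))
    ` carrier (tensor_power R L 3)"

definition kill ::
  "('a, 'r) ring_scheme \<Rightarrow> ('a, 'b, 'm) lie_scheme \<Rightarrow> ('a, ('b list \<Rightarrow> 'a) set set set) module"
  where "kill R L = quotient_module (sym_square R L) (kill_null R L)"

definition kill_class ::
  "('a, 'r) ring_scheme \<Rightarrow> ('a, 'b, 'm) lie_scheme \<Rightarrow> ('b list \<Rightarrow> 'a) set set \<Rightarrow> ('b list \<Rightarrow> 'a) set set set"
  where "kill_class R L s = kill_null R L +>\<^bsub>sym_square R L\<^esub> s"

definition kill_map ::
  "('a, 'r) ring_scheme \<Rightarrow> ('a, 'c, 'n) lie_scheme \<Rightarrow> ('b \<Rightarrow> 'c) \<Rightarrow>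
    ('b list \<Rightarrow> 'a) set set set \<Rightarrow> ('c list \<Rightarrow> 'a) set set set"
  where "kill_map R L' f = induced (\<lambda>s. kill_class R L' (sym_square_map R L' f s))"

definition koszul ::
  "('a, 'r) ring_scheme \<Rightarrow> ('a, 'b, 'm) lie_scheme \<Rightarrow> ('b list \<Rightarrow> 'a) set set \<Rightarrow> ('b list \<Rightarrow> 'a) set set set"
  where "koszul R L = ext_lift R (kill R L)
    (\<lambda>xs. kill_class R L (sym_prod R L (xs ! 0) (bracket L (xs ! 1) (xs ! 2))))"

text \<open>The elements of \<open>ce_homology R L 3\<close> are cosets contained in \<open>ce_cycles R L 3\<close>.\<close>

definition reduced_koszul ::
  "('a, 'r) ring_scheme \<Rightarrow> ('a, 'b, 'm) lie_scheme \<Rightarrow> ('b list \<Rightarrow> 'a) set set set \<Rightarrow> ('b list \<Rightarrow> 'a) set set set"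
  where "reduced_koszul R L = induced (koszul R L)"


section \<open>Induced gradings\<close>

definition ext_power_degree ::
  "('a, 'r) ring_scheme \<Rightarrow> ('a, 'b, 'm) module_scheme \<Rightarrow> (nat \<Rightarrow> 'b set) \<Rightarrow> nat \<Rightarrow> nat \<Rightarrow> ('b list \<Rightarrow> 'a) set set set"
  where "ext_power_degree R M G k n = module_span R (ext_power R M k)
    {wedge R M xs | xs ds. length xs = k \<and> list_all2 (\<lambda>x d. x \<in> G d) xs ds \<and> sum_list ds = n}"

definition sym_square_degree ::
  "('a, 'r) ring_scheme \<Rightarrow> ('a, 'b, 'm) module_scheme \<Rightarrow> (nat \<Rightarrow> 'b set) \<Rightarrow> nat \<Rightarrow> ('b list \<Rightarrow> 'a) set set set"
  where "sym_square_degree R M G n = module_span R (sym_square R M)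
    {sym_prod R M x y | x y i j. x \<in> G i \<and> y \<in> G j \<and> i + j = n}"

definition ce_homology_degree ::
  "('a, 'r) ring_scheme \<Rightarrow> ('a, 'b, 'm) lie_scheme \<Rightarrow> (nat \<Rightarrow> 'b set) \<Rightarrow> nat \<Rightarrow> nat \<Rightarrow> ('b list \<Rightarrow> 'a) set set set set"
  where "ce_homology_degree R L G k n =
    homology_class R L k ` (ce_cycles R L k \<inter> ext_power_degree R L G k n)"

definition kill_degree ::
  "('a, 'r) ring_scheme \<Rightarrow> ('a, 'b, 'm) lie_scheme \<Rightarrow> (nat \<Rightarrow> 'b set) \<Rightarrow> nat \<Rightarrow> ('b list \<Rightarrow> 'a) set set set set"
  where "kill_degree R L G n = kill_class R L ` sym_square_degree R L G n"

end

theory Submission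
  imports Defs
begin

text \<open>
  Write \<open>B(x, y)\<close> for the class of \<open>x \<odot> y\<close> in the Killing module and let \<open>D\<close> be the linear
  map acting on degree \<open>n\<close> as multiplication by \<open>n\<close>. The alternating bilinear map
  \<open>\<Phi>(x \<and> y) = B(D x, y) - B(x, D y)\<close> satisfies \<open>\<Phi>(\<partial>\<^sub>3 v) = - n \<eta>(v)\<close> for \<open>v\<close> of degree \<open>n\<close>,
  because \<open>B([x, y], z)\<close> is invariant under cyclic permutations. Hence \<open>n \<eta>\<close> vanishes on cycles
  of degree \<open>n\<close>, and so does \<open>\<eta>\<close> when \<open>n\<close> is invertible.

  In degree \<open>0\<close>, the projection \<open>\<gg> \<rightarrow> \<gg>\<^sub>0\<close> is a homomorphism of Lie algebras since all degrees
  are nonnegative. It is a left inverse of the inclusion, and on the parts of degree \<open>0\<close>, which are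
  spanned by products of elements of \<open>\<gg>\<^sub>0\<close>, it induces a right inverse as well.
\<close>

section \<open>Module homomorphisms and submodules\<close>

text \<open>The minus sign in \<Phi> does two things. Since B is symmetric, it makes \<Phi>
  alternating, so that \<Phi> descends to the exterior square. It also fixes the weights: for
  entries of degrees i, j, k and t = B(x, [y, z]), the three terms of the boundary contribute i + j
  - k, i + k - j and j + k - i times t, all with the same sign, and these weights add up to i + j +
  k. The bulk of the work is well-definedness. Every map out of a tensor, exterior or symmetric
  power, out of homology or out of the Killing module is encoded as the common value of a function
  on a coset, and such an expression carries information only once the function is known to be
  constant there. Multilinearity, alternation or symmetry, and vanishing on boundaries or relations
  must therefore be established before any formula for these maps is available. In return, all these
  modules are spanned by classes of pure elements, so an identity between linear maps becomes a
  computation with at most four vectors.\<close>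

lemma module_homI:
  assumes "\<And>x. x \<in> carrier M \<Longrightarrow> f x \<in> carrier N"
    and "\<And>x y. x \<in> carrier M \<Longrightarrow> y \<in> carrier M \<Longrightarrow> f (x \<oplus>\<^bsub>M\<^esub> y) = f x \<oplus>\<^bsub>N\<^esub> f y"
    and "\<And>a x. a \<in> carrier R \<Longrightarrow> x \<in> carrier M \<Longrightarrow> f (a \<odot>\<^bsub>M\<^esub> x) = a \<odot>\<^bsub>N\<^esub> f x"
  shows "f \<in> module_hom R M N"
  using assms by (auto simp: module_hom_def)

lemma module_hom_closed: "f \<in> module_hom R M N \<Longrightarrow> x \<in> carrier M \<Longrightarrow> f x \<in> carrier N"
  by (auto simp: module_hom_def)

lemma module_hom_add:
  "f \<in> module_hom R M N \<Longrightarrow> x \<in> carrier M \<Longrightarrow> y \<in> carrier M \<Longrightarrow> f (x \<oplus>\<^bsub>M\<^esub> y) = f x \<oplus>\<^bsub>N\<^esub> f y"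
  by (auto simp: module_hom_def)

lemma module_hom_smult:
  "f \<in> module_hom R M N \<Longrightarrow> a \<in> carrier R \<Longrightarrow> x \<in> carrier M \<Longrightarrow> f (a \<odot>\<^bsub>M\<^esub> x) = a \<odot>\<^bsub>N\<^esub> f x"
  by (auto simp: module_hom_def)

lemma module_hom_id: "(\<lambda>x. x) \<in> module_hom R M M"
  by (simp add: module_hom_def)

lemma module_hom_comp:
  assumes "f \<in> module_hom R M N" "g \<in> module_hom R N P"
  shows "(\<lambda>x. g (f x)) \<in> module_hom R M P"
  using assms by (auto simp: module_hom_def Pi_def)

lemma module_neg_eq_smult:
  assumes "module R M" "x \<in> carrier M"
  shows "\<ominus>\<^bsub>M\<^esub> x = (\<ominus>\<^bsub>R\<^esub> \<one>\<^bsub>R\<^esub>) \<odot>\<^bsub>M\<^esub> x"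
proof -
  interpret module R M by fact
  show ?thesis using assms(2) by (simp add: smult_l_minus)
qed

lemma module_hom_zero:
  assumes "module R M" "module R N" "f \<in> module_hom R M N"
  shows "f \<zero>\<^bsub>M\<^esub> = \<zero>\<^bsub>N\<^esub>"
proof -
  interpret M: module R M by fact
  interpret N: module R N by fact
  have "f (\<zero>\<^bsub>R\<^esub> \<odot>\<^bsub>M\<^esub> \<zero>\<^bsub>M\<^esub>) = \<zero>\<^bsub>R\<^esub> \<odot>\<^bsub>N\<^esub> f \<zero>\<^bsub>M\<^esub>"
    using assms(3) by (intro module_hom_smult) auto
  then show ?thesis using module_hom_closed[OF assms(3) M.zero_closed] by simp
qed

lemma module_hom_neg:
  assumes "module R M" "module R N" "f \<in> module_hom R M N" "x \<in> carrier M"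
  shows "f (\<ominus>\<^bsub>M\<^esub> x) = \<ominus>\<^bsub>N\<^esub> f x"
proof -
  interpret M: module R M by fact
  interpret N: module R N by fact
  show ?thesis
    using assms(3,4) module_hom_closed[OF assms(3,4)]
    by (simp add: module_neg_eq_smult[OF assms(1)] module_neg_eq_smult[OF assms(2)]
        module_hom_smult[OF assms(3)])
qed

lemma module_hom_diff:
  assumes "module R M" "module R N" "f \<in> module_hom R M N" "x \<in> carrier M" "y \<in> carrier M"
  shows "f (x \<ominus>\<^bsub>M\<^esub> y) = f x \<ominus>\<^bsub>N\<^esub> f y"
proof -
  interpret M: module R M by fact
  show ?thesis
    using assms by (simp add: a_minus_def module_hom_add[OF assms(3)] module_hom_neg)
qed

lemma zero_module_hom:
  assumes "module R N"
  shows "(\<lambda>x. \<zero>\<^bsub>N\<^esub>) \<in> module_hom R M N"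
proof -
  interpret N: module R N by fact
  show ?thesis by (rule module_homI) auto
qed

lemma module_hom_smult_pointwise:
  assumes "module R N" "f \<in> module_hom R M N" "a \<in> carrier R"
  shows "(\<lambda>x. a \<odot>\<^bsub>N\<^esub> f x) \<in> module_hom R M N"
proof -
  interpret N: module R N by fact
  show ?thesis
  proof (rule module_homI)
    fix b x assume "b \<in> carrier R" "x \<in> carrier M"
    then show "a \<odot>\<^bsub>N\<^esub> f (b \<odot>\<^bsub>M\<^esub> x) = b \<odot>\<^bsub>N\<^esub> (a \<odot>\<^bsub>N\<^esub> f x)"
      using assms(3) module_hom_closed[OF assms(2)]
      by (simp add: module_hom_smult[OF assms(2)] N.smult_assoc1[symmetric] N.m_comm)
  qed (use assms module_hom_closed[OF assms(2)] in
      \<open>auto simp: module_hom_add[OF assms(2)] N.smult_r_distr\<close>)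
qed

lemma module_hom_add_pointwise:
  assumes "module R N" "f \<in> module_hom R M N" "g \<in> module_hom R M N"
  shows "(\<lambda>x. f x \<oplus>\<^bsub>N\<^esub> g x) \<in> module_hom R M N"
proof -
  interpret N: module R N by fact
  show ?thesis
    by (rule module_homI)
      (use module_hom_closed[OF assms(2)] module_hom_closed[OF assms(3)] in
        \<open>auto simp: module_hom_add[OF assms(2)] module_hom_add[OF assms(3)]
          module_hom_smult[OF assms(2)] module_hom_smult[OF assms(3)] N.smult_r_distr N.a_ac\<close>)
qed

lemma module_hom_neg_pointwise:
  assumes "module R N" "f \<in> module_hom R M N"
  shows "(\<lambda>x. \<ominus>\<^bsub>N\<^esub> f x) \<in> module_hom R M N"
proof -
  interpret N: module R N by fact
  show ?thesis
    by (rule module_homI)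
      (use module_hom_closed[OF assms(2)] in
        \<open>auto simp: module_hom_add[OF assms(2)] module_hom_smult[OF assms(2)] N.minus_add N.smult_r_minus\<close>)
qed

lemma module_hom_diff_pointwise:
  assumes "module R N" "f \<in> module_hom R M N" "g \<in> module_hom R M N"
  shows "(\<lambda>x. f x \<ominus>\<^bsub>N\<^esub> g x) \<in> module_hom R M N"
  unfolding a_minus_def
  by (intro module_hom_add_pointwise module_hom_neg_pointwise assms)

lemma module_hom_cong:
  assumes "\<And>x. x \<in> carrier M \<Longrightarrow> f x = g x" "module R M"
  shows "f \<in> module_hom R M N \<longleftrightarrow> g \<in> module_hom R M N"
proof -
  interpret module R M by fact
  show ?thesis using assms(1) by (auto simp: module_hom_def Pi_def)
qed

lemma submodule_carrier: "submodule H R M \<Longrightarrow> x \<in> H \<Longrightarrow> x \<in> carrier M"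
  using subgroup.subset submodule.axioms(1) by fastforce

lemma submodule_additive: "submodule H R M \<Longrightarrow> additive_subgroup H M"
  by (simp add: additive_subgroup.intro submodule.axioms(1))

lemma submodule_zero: "submodule H R M \<Longrightarrow> \<zero>\<^bsub>M\<^esub> \<in> H"
  using submodule_additive additive_subgroup.zero_closed by blast

lemma submodule_add: "submodule H R M \<Longrightarrow> x \<in> H \<Longrightarrow> y \<in> H \<Longrightarrow> x \<oplus>\<^bsub>M\<^esub> y \<in> H"
  using submodule_additive additive_subgroup.a_closed by metis

lemma submodule_finsum:
  assumes "module R M" "submodule H R M" "finite A" "\<And>i. i \<in> A \<Longrightarrow> g i \<in> H"
  shows "(\<Oplus>\<^bsub>M\<^esub>i\<in>A. g i) \<in> H"
proof -
  interpret M: module R M by fact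
  show ?thesis using assms(3,4)
  proof (induction A rule: finite_induct)
    case (insert i A)
    have "g \<in> A \<rightarrow> carrier M" "g i \<in> carrier M"
      using insert.prems submodule_carrier[OF assms(2)] by auto
    then show ?case using insert submodule_add[OF assms(2)] by simp
  qed (simp add: submodule_zero[OF assms(2)])
qed

text \<open>A negative is the multiple by -1, so closure under negation follows from closure under
  scalars.\<close>

lemma submoduleI_smult:
  assumes "module R M" "H \<subseteq> carrier M" "\<zero>\<^bsub>M\<^esub> \<in> H"
    and "\<And>x y. x \<in> H \<Longrightarrow> y \<in> H \<Longrightarrow> x \<oplus>\<^bsub>M\<^esub> y \<in> H"
    and "\<And>a x. a \<in> carrier R \<Longrightarrow> x \<in> H \<Longrightarrow> a \<odot>\<^bsub>M\<^esub> x \<in> H"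
  shows "submodule H R M"
proof -
  interpret M: module R M by fact
  show ?thesis
    by (rule M.submoduleI) (use assms in \<open>auto simp: module_neg_eq_smult[OF assms(1)] subset_iff\<close>)
qed

text \<open>Agreement of two linear maps is preserved by sums and multiples, so it passes from
  generators to their span. Kernels are the case where one of the maps is zero.\<close>

lemma submodule_equalizer:
  assumes M: "module R M" and N: "module R N"
    and f: "f \<in> module_hom R M N" and g: "g \<in> module_hom R M N"
  shows "submodule {x \<in> carrier M. f x = g x} R M"
proof -
  interpret M: module R M by fact
  show ?thesis
    by (rule submoduleI_smult[OF M])
      (use f g in \<open>auto simp: module_hom_zero[OF M N] module_hom_add module_hom_smult\<close>)
qed

text \<open>Serves to propagate membership: once all generators are mapped into \<open>H\<close>,
  everything spanned by them is.\<close>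

lemma submodule_vimage:
  assumes M: "module R M" and N: "module R N"
    and f: "f \<in> module_hom R M N" and H: "submodule H R N"
  shows "submodule {x \<in> carrier M. f x \<in> H} R M"
proof -
  interpret M: module R M by fact
  show ?thesis
    by (rule submoduleI_smult[OF M])
      (use f H in \<open>auto simp: module_hom_zero[OF M N] module_hom_add module_hom_smult
         submodule_zero submodule_add submodule.smult_closed\<close>)
qed

lemma submodule_image:
  assumes M: "module R M" and N: "module R N" and f: "f \<in> module_hom R M N"
  shows "submodule (f ` carrier M) R N"
proof -
  interpret M: module R M by fact
  show ?thesis
  proof (rule submoduleI_smult[OF N])
    show "f ` carrier M \<subseteq> carrier N" using module_hom_closed[OF f] by auto
    show "\<zero>\<^bsub>N\<^esub> \<in> f ` carrier M" using module_hom_zero[OF M N f] M.zero_closed by force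
  next
    fix x y assume "x \<in> f ` carrier M" "y \<in> f ` carrier M"
    then obtain u v where "x = f u" "y = f v" "u \<in> carrier M" "v \<in> carrier M" by auto
    then show "x \<oplus>\<^bsub>N\<^esub> y \<in> f ` carrier M"
      using module_hom_add[OF f, of u v] by (metis M.a_closed imageI)
  next
    fix a x assume "a \<in> carrier R" "x \<in> f ` carrier M"
    then obtain u where "x = f u" "u \<in> carrier M" by auto
    then show "a \<odot>\<^bsub>N\<^esub> x \<in> f ` carrier M"
      using \<open>a \<in> carrier R\<close> module_hom_smult[OF f, of a u] by (metis M.smult_closed imageI)
  qed
qed

lemma submodule_kernel:
  assumes "module R M" "module R N" "f \<in> module_hom R M N"
  shows "submodule (a_kernel M N f) R M"
  using submodule_equalizer[OF assms zero_module_hom[OF assms(2)]]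
  by (simp add: a_kernel_def')

lemma submodule_of_submodule:
  assumes "module R M" "submodule Z R M" "submodule H R M" "H \<subseteq> Z"
  shows "submodule H R (M\<lparr>carrier := Z\<rparr>)"
  by (rule submoduleI_smult[OF submodule.submodule_is_module[OF assms(2,1)]])
    (use assms(4) in \<open>auto simp: submodule_zero[OF assms(3)] submodule_add[OF assms(3)]
       submodule.smult_closed[OF assms(3)]\<close>)

lemma module_span_superset: "S \<subseteq> module_span R M S"
  by (auto simp: module_span_def)

lemma module_span_minimal: "submodule N R M \<Longrightarrow> S \<subseteq> N \<Longrightarrow> module_span R M S \<subseteq> N"
  by (auto simp: module_span_def)

lemma module_span_submodule:
  assumes "module R M" "S \<subseteq> carrier M"
  shows "submodule (module_span R M S) R M"
proof -
  interpret M: module R M by fact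
  show ?thesis
  proof (rule submoduleI_smult[OF assms(1)])
    show "module_span R M S \<subseteq> carrier M"
      by (intro module_span_minimal M.carrier_is_submodule assms(2))
  qed (auto simp: module_span_def submodule_zero submodule_add submodule.smult_closed)
qed

text \<open>The set of agreement is a submodule containing \<open>S\<close>, hence contains its
  span. With a zero map on one side, this is the usual way of proving that a lift vanishes on a null
  module.\<close>

lemma module_hom_eq_on_span:
  assumes "module R M" "module R N" "f \<in> module_hom R M N" "g \<in> module_hom R M N"
    and "S \<subseteq> carrier M" "\<And>x. x \<in> S \<Longrightarrow> f x = g x" "x \<in> module_span R M S"
  shows "f x = g x"
  using module_span_minimal[OF submodule_equalizer[OF assms(1-4)], of S] assms(5-7) by auto

section \<open>Quotient modules\<close>

lemma (in abelian_group) additive_subgroup_abelian: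
  "additive_subgroup H G \<Longrightarrow> abelian_subgroup H G"
  by (simp add: abelian_subgroupI3 abelian_group_axioms)

locale quotient_by = module R M for R (structure) and M (structure) +
  fixes N assumes submodule: "submodule N R M"
begin

sublocale abelian_subgroup N M
  by (intro additive_subgroup_abelian submodule_additive[OF submodule])

abbreviation "Q \<equiv> quotient_module M N"

lemma carrier_quotient: "carrier Q = (\<lambda>x. N +>\<^bsub>M\<^esub> x) ` carrier M"
  by (auto simp: quotient_module_def A_RCOSETS_def')

lemma add_quotient:
  "x \<in> carrier M \<Longrightarrow> y \<in> carrier M \<Longrightarrow> (N +>\<^bsub>M\<^esub> x) \<oplus>\<^bsub>Q\<^esub> (N +>\<^bsub>M\<^esub> y) = N +>\<^bsub>M\<^esub> (x \<oplus>\<^bsub>M\<^esub> y)"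
  by (simp add: quotient_module_def a_rcos_sum)

lemma zero_quotient: "\<zero>\<^bsub>Q\<^esub> = N"
  by (simp add: quotient_module_def)

lemma coset_eq_iff:
  assumes "x \<in> carrier M" "y \<in> carrier M"
  shows "N +>\<^bsub>M\<^esub> x = N +>\<^bsub>M\<^esub> y \<longleftrightarrow> x \<ominus>\<^bsub>M\<^esub> y \<in> N"
proof
  assume "N +>\<^bsub>M\<^esub> x = N +>\<^bsub>M\<^esub> y"
  then have "x \<in> N +>\<^bsub>M\<^esub> y" using a_rcos_self[OF assms(1)] by simp
  then obtain h where "h \<in> N" "x = h \<oplus>\<^bsub>M\<^esub> y" by (auto simp: a_r_coset_def')
  then show "x \<ominus>\<^bsub>M\<^esub> y \<in> N"
    using assms submodule_carrier[OF submodule] by (simp add: a_minus_def M.a_assoc M.r_neg)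
next
  assume *: "x \<ominus>\<^bsub>M\<^esub> y \<in> N"
  have "x = (x \<ominus>\<^bsub>M\<^esub> y) \<oplus>\<^bsub>M\<^esub> y" using assms by (simp add: a_minus_def M.a_assoc M.l_neg)
  then have "x \<in> N +>\<^bsub>M\<^esub> y" using * unfolding a_r_coset_def' by blast
  then show "N +>\<^bsub>M\<^esub> x = N +>\<^bsub>M\<^esub> y"
    using M.a_repr_independence[OF _ assms(2) a_subgroup] by simp
qed

lemma coset_carrier: "x \<in> carrier M \<Longrightarrow> u \<in> N +>\<^bsub>M\<^esub> x \<Longrightarrow> u \<in> carrier M"
  using M.a_r_coset_subset_G a_subset by blast

lemma coset_repr: "x \<in> carrier M \<Longrightarrow> u \<in> N +>\<^bsub>M\<^esub> x \<Longrightarrow> N +>\<^bsub>M\<^esub> u = N +>\<^bsub>M\<^esub> x"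
  using M.a_repr_independence[OF _ _ a_subgroup] by simp

lemma coset_eq_zero_iff: "x \<in> carrier M \<Longrightarrow> N +>\<^bsub>M\<^esub> x = \<zero>\<^bsub>Q\<^esub> \<longleftrightarrow> x \<in> N"
  unfolding zero_quotient
  using M.a_coset_join1 M.a_coset_join2 a_subgroup by metis

text \<open>The scalar action on cosets is a union over all representatives. It collapses to a
  single coset because \<open>a\<close> times the difference of two representatives stays in
  \<open>N\<close>.\<close>

lemma smult_quotient:
  assumes a: "a \<in> carrier R" and x: "x \<in> carrier M"
  shows "a \<odot>\<^bsub>Q\<^esub> (N +>\<^bsub>M\<^esub> x) = N +>\<^bsub>M\<^esub> (a \<odot>\<^bsub>M\<^esub> x)"
proof -
  have "N +>\<^bsub>M\<^esub> (a \<odot>\<^bsub>M\<^esub> u) = N +>\<^bsub>M\<^esub> (a \<odot>\<^bsub>M\<^esub> x)" if u: "u \<in> N +>\<^bsub>M\<^esub> x" for u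
  proof -
    have uc: "u \<in> carrier M" using coset_carrier[OF x u] .
    have "a \<odot>\<^bsub>M\<^esub> (u \<ominus>\<^bsub>M\<^esub> x) \<in> N"
      using coset_eq_iff[OF uc x] coset_repr[OF x u] submodule.smult_closed[OF submodule a] by simp
    then show ?thesis
      using a x uc by (simp add: coset_eq_iff a_minus_def smult_r_distr smult_r_minus)
  qed
  then have "(\<Union>u\<in>N +>\<^bsub>M\<^esub> x. N +>\<^bsub>M\<^esub> (a \<odot>\<^bsub>M\<^esub> u)) = N +>\<^bsub>M\<^esub> (a \<odot>\<^bsub>M\<^esub> x)"
    using a_rcos_self[OF x] by (intro SUP_eq_const) blast+
  then show ?thesis by (simp add: quotient_module_def)
qed

lemma quotient_module_is_module: "module R Q"
proof (rule moduleI)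
  show "abelian_group Q"
  proof (rule abelian_groupI)
    fix C assume "C \<in> carrier Q"
    then obtain x where x: "x \<in> carrier M" "C = N +>\<^bsub>M\<^esub> x" by (auto simp: carrier_quotient)
    then have "(N +>\<^bsub>M\<^esub> (\<ominus>\<^bsub>M\<^esub> x)) \<oplus>\<^bsub>Q\<^esub> C = \<zero>\<^bsub>Q\<^esub>" "N +>\<^bsub>M\<^esub> (\<ominus>\<^bsub>M\<^esub> x) \<in> carrier Q"
      by (auto simp: carrier_quotient add_quotient coset_eq_zero_iff M.l_neg)
    then show "\<exists>D\<in>carrier Q. D \<oplus>\<^bsub>Q\<^esub> C = \<zero>\<^bsub>Q\<^esub>" by blast
  next
    have "\<zero>\<^bsub>Q\<^esub> = N +>\<^bsub>M\<^esub> \<zero>\<^bsub>M\<^esub>" using coset_eq_zero_iff[of "\<zero>\<^bsub>M\<^esub>"] by simp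
    then show "\<zero>\<^bsub>Q\<^esub> \<in> carrier Q" "\<And>C. C \<in> carrier Q \<Longrightarrow> \<zero>\<^bsub>Q\<^esub> \<oplus>\<^bsub>Q\<^esub> C = C"
      by (auto simp: carrier_quotient add_quotient)
  qed (auto simp: carrier_quotient add_quotient M.a_ac)
qed (auto simp: carrier_quotient add_quotient smult_quotient R.is_cring
    smult_l_distr smult_r_distr smult_assoc1)

lemma coset_hom: "(\<lambda>x. N +>\<^bsub>M\<^esub> x) \<in> module_hom R M Q"
  by (rule module_homI) (auto simp: carrier_quotient add_quotient smult_quotient)

context
  fixes P :: "('a, 'e, 'n) module_scheme" and f
  assumes P: "module R P" and f: "f \<in> module_hom R M P"
    and f0: "\<And>x. x \<in> N \<Longrightarrow> f x = \<zero>\<^bsub>P\<^esub>"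
begin

text \<open>A linear map that kills \<open>N\<close> is constant on each coset, so the image of the
  coset is a singleton and \<open>the_elem\<close> returns the intended value.\<close>

lemma induced_coset:
  assumes x: "x \<in> carrier M"
  shows "induced f (N +>\<^bsub>M\<^esub> x) = f x"
proof -
  interpret P: module R P by (rule P)
  have "f (h \<oplus>\<^bsub>M\<^esub> x) = f x" if "h \<in> N" for h
    using that x module_hom_closed[OF f x] submodule_carrier[OF submodule]
    by (simp add: module_hom_add[OF f] f0)
  then have "f u = f x" if "u \<in> N +>\<^bsub>M\<^esub> x" for u
    using that by (auto simp: a_r_coset_def')
  then have "f ` (N +>\<^bsub>M\<^esub> x) = {f x}"
    using a_rcos_self[OF x] by (metis equals0D image_cong image_constant_conv)
  then show ?thesis by (simp add: induced_def)
qed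

lemma induced_hom: "induced f \<in> module_hom R Q P"
  by (rule module_homI)
    (auto simp: carrier_quotient add_quotient smult_quotient induced_coset
      module_hom_closed[OF f] module_hom_add[OF f] module_hom_smult[OF f])

end

end

text \<open>The elements of \<open>M\<close> whose coset lies in the span of the images form a
  submodule containing \<open>S\<close>, hence make up all of \<open>M\<close>.\<close>

lemma (in quotient_by) quotient_span:
  assumes S: "S \<subseteq> carrier M" and gen: "module_span R M S = carrier M"
  shows "module_span R Q ((\<lambda>x. N +>\<^bsub>M\<^esub> x) ` S) = carrier Q"
proof -
  let ?T = "(\<lambda>x. N +>\<^bsub>M\<^esub> x) ` S"
  have T: "?T \<subseteq> carrier Q" using S by (auto simp: carrier_quotient)
  have H: "submodule (module_span R Q ?T) R Q"
    by (rule module_span_submodule[OF quotient_module_is_module T])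
  have "submodule {x \<in> carrier M. N +>\<^bsub>M\<^esub> x \<in> module_span R Q ?T} R M"
    by (rule submodule_vimage[OF module_axioms quotient_module_is_module coset_hom H])
  then have "module_span R M S \<subseteq> {x \<in> carrier M. N +>\<^bsub>M\<^esub> x \<in> module_span R Q ?T}"
    by (rule module_span_minimal) (use S module_span_superset in fast)
  then have "carrier Q \<subseteq> module_span R Q ?T"
    using gen by (auto simp: carrier_quotient)
  then show ?thesis using submodule_carrier[OF H] by blast
qed

lemma a_r_coset_carrier: "H +>\<^bsub>M\<lparr>carrier := Z\<rparr>\<^esub> x = H +>\<^bsub>M\<^esub> x"
  by (simp add: a_r_coset_def')

section \<open>Free modules\<close>

locale free_module_on = cring R for R (structure) +
  fixes S :: "'x set"
begin

abbreviation "F \<equiv> free_module R S"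

lemma free_module_simps:
  "\<zero>\<^bsub>F\<^esub> = (\<lambda>x. \<zero>)" "p \<oplus>\<^bsub>F\<^esub> q = (\<lambda>x. p x \<oplus> q x)" "a \<odot>\<^bsub>F\<^esub> p = (\<lambda>x. a \<otimes> p x)"
  by (simp_all add: free_module_def)

text \<open>Outside \<open>S\<close> the value is zero and thus lies in \<open>R\<close> anyway, so
  the coefficient condition can be asked at every point and the support condition
  separately.\<close>

lemma free_module_carrier:
  "p \<in> carrier F \<longleftrightarrow> (\<forall>x. p x \<in> carrier R) \<and> {x. p x \<noteq> \<zero>} \<subseteq> S \<and> finite {x. p x \<noteq> \<zero>}"
  by (force simp: free_module_def)

lemma free_module_is_module: "module R F"
proof (rule moduleI)
  have fin: "finite {x. p x \<oplus> q x \<noteq> \<zero>}" if "finite {x. p x \<noteq> \<zero>}" "finite {x. q x \<noteq> \<zero>}"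
    for p q :: "'x \<Rightarrow> 'a"
    by (rule finite_subset[OF _ finite_UnI[OF that]]) auto
  have fin': "finite {x. a \<otimes> p x \<noteq> \<zero>}" if "finite {x. p x \<noteq> \<zero>}" "a \<in> carrier R"
    for p :: "'x \<Rightarrow> 'a" and a
    by (rule finite_subset[OF _ that(1)]) (use that(2) in auto)
  show "abelian_group F"
  proof (rule abelian_groupI)
    fix p assume p: "p \<in> carrier F"
    \<comment> \<open>The additive inverse is taken as the multiple by -1, whose finite support is
      an instance of \<open>fin'\<close>.\<close>
    have "(\<lambda>x. (\<ominus> \<one>) \<otimes> p x) \<in> carrier F"
      using p fin'[of p "\<ominus> \<one>"] by (auto simp: free_module_carrier)
    moreover have "(\<lambda>x. (\<ominus> \<one>) \<otimes> p x) \<oplus>\<^bsub>F\<^esub> p = \<zero>\<^bsub>F\<^esub>"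
      using p by (auto simp: free_module_carrier free_module_simps l_minus l_neg)
    ultimately show "\<exists>q\<in>carrier F. q \<oplus>\<^bsub>F\<^esub> p = \<zero>\<^bsub>F\<^esub>" by blast
  next
    fix p q assume "p \<in> carrier F" "q \<in> carrier F"
    then show "p \<oplus>\<^bsub>F\<^esub> q \<in> carrier F"
      using fin[of p q] by (force simp: free_module_carrier free_module_simps)
  qed (auto simp: free_module_carrier free_module_simps a_ac)
  fix a p assume "a \<in> carrier R" "p \<in> carrier F"
  then show "a \<odot>\<^bsub>F\<^esub> p \<in> carrier F"
    using fin'[of p a] by (auto simp: free_module_carrier free_module_simps)
qed (auto simp: free_module_carrier free_module_simps is_cring l_distr r_distr m_assoc)

lemma free_gen_carrier: "x \<in> S \<Longrightarrow> free_gen R x \<in> carrier F"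
  by (auto simp: free_module_carrier free_gen_def)

text \<open>Induction on the support: clearing one coefficient leaves a function with smaller
  support, and the removed summand is a multiple of a generator.\<close>

lemma free_module_span: "module_span R F (free_gen R ` S) = carrier F"
proof (intro equalityI subsetI)
  interpret F: module R F by (rule free_module_is_module)
  fix p assume "p \<in> module_span R F (free_gen R ` S)"
  moreover have "submodule (module_span R F (free_gen R ` S)) R F"
    using free_gen_carrier by (intro module_span_submodule free_module_is_module) auto
  ultimately show "p \<in> carrier F" using submodule_carrier by metis
next
  let ?H = "module_span R F (free_gen R ` S)"
  have H: "submodule ?H R F"
    using free_gen_carrier by (intro module_span_submodule free_module_is_module) auto
  fix p assume "p \<in> carrier F"
  moreover have "p \<in> ?H" if "finite T" "p \<in> carrier F" "{x. p x \<noteq> \<zero>} = T" for T p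
    using that
  proof (induction T arbitrary: p rule: finite_induct)
    case empty
    then have "p = \<zero>\<^bsub>F\<^esub>" by (auto simp: free_module_simps)
    then show ?case using submodule_zero[OF H] by simp
  next
    case (insert t T)
    let ?q = "p(t := \<zero>)"
    have t: "t \<in> S" "p t \<in> carrier R" using insert.prems by (auto simp: free_module_carrier)
    have supp: "{x. ?q x \<noteq> \<zero>} = T" using insert by auto
    have "?q \<in> ?H"
      using insert supp by (intro insert.IH) (auto simp: free_module_carrier)
    moreover have "free_gen R t \<in> ?H"
      by (rule subsetD[OF module_span_superset]) (use t in simp)
    ultimately have "?q \<oplus>\<^bsub>F\<^esub> (p t \<odot>\<^bsub>F\<^esub> free_gen R t) \<in> ?H"
      using H t by (intro submodule_add[OF H] submodule.smult_closed) auto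
    also have "?q \<oplus>\<^bsub>F\<^esub> (p t \<odot>\<^bsub>F\<^esub> free_gen R t) = p"
      using insert.prems by (auto simp: free_module_simps free_gen_def free_module_carrier)
    finally show ?case .
  qed
  ultimately show "p \<in> ?H" by (auto simp: free_module_carrier)
qed

context
  fixes P :: "('a, 'e, 'n) module_scheme" and \<phi>
  assumes P: "module R P" and \<phi>: "\<phi> \<in> S \<rightarrow> carrier P"
begin

text \<open>The defining sum runs over the exact support, which can shrink for a sum or a multiple.
  A larger common index set makes the sums for different functions comparable.\<close>

lemma free_lift_superset:
  assumes "p \<in> carrier F" "finite T" "{x. p x \<noteq> \<zero>} \<subseteq> T" "T \<subseteq> S"
  shows "free_lift R P \<phi> p = (\<Oplus>\<^bsub>P\<^esub>x\<in>T. p x \<odot>\<^bsub>P\<^esub> \<phi> x)"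
proof -
  interpret P: module R P by (rule P)
  show ?thesis
    unfolding free_lift_def
    by (rule P.add.finprod_mono_neutral_cong_left)
      (use assms \<phi> in \<open>auto simp: free_module_carrier Pi_def subset_iff\<close>)
qed

lemma free_lift_hom: "free_lift R P \<phi> \<in> module_hom R F P"
proof (rule module_homI)
  interpret P: module R P by (rule P)
  interpret F: module R F by (rule free_module_is_module)
  have in_P: "(\<lambda>x. p x \<odot>\<^bsub>P\<^esub> \<phi> x) \<in> T \<rightarrow> carrier P" if "p \<in> carrier F" "T \<subseteq> S" for p T
    using that \<phi> by (auto simp: free_module_carrier Pi_def subset_iff)
  fix p assume p: "p \<in> carrier F"
  then show "free_lift R P \<phi> p \<in> carrier P"
    unfolding free_lift_def by (intro P.finsum_closed in_P) (auto simp: free_module_carrier)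
  let ?s = "\<lambda>p. {x. p x \<noteq> \<zero>}"
  {
    fix q assume q: "q \<in> carrier F"
    let ?T = "?s p \<union> ?s q"
    have T: "finite ?T" "?T \<subseteq> S" using p q by (auto simp: free_module_carrier)
    have "?s (p \<oplus>\<^bsub>F\<^esub> q) \<subseteq> ?T" by (auto simp: free_module_simps)
    then have "free_lift R P \<phi> (p \<oplus>\<^bsub>F\<^esub> q) = (\<Oplus>\<^bsub>P\<^esub>x\<in>?T. (p \<oplus>\<^bsub>F\<^esub> q) x \<odot>\<^bsub>P\<^esub> \<phi> x)"
      using p q T by (intro free_lift_superset) auto
    also have "\<dots> = (\<Oplus>\<^bsub>P\<^esub>x\<in>?T. p x \<odot>\<^bsub>P\<^esub> \<phi> x \<oplus>\<^bsub>P\<^esub> q x \<odot>\<^bsub>P\<^esub> \<phi> x)"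
      using p q T \<phi> in_P
      by (intro P.finsum_cong') (auto simp: free_module_simps free_module_carrier Pi_def P.smult_l_distr subset_iff)
    also have "\<dots> = (\<Oplus>\<^bsub>P\<^esub>x\<in>?T. p x \<odot>\<^bsub>P\<^esub> \<phi> x) \<oplus>\<^bsub>P\<^esub> (\<Oplus>\<^bsub>P\<^esub>x\<in>?T. q x \<odot>\<^bsub>P\<^esub> \<phi> x)"
      using p q T by (intro P.finsum_addf in_P)
    also have "\<dots> = free_lift R P \<phi> p \<oplus>\<^bsub>P\<^esub> free_lift R P \<phi> q"
      using p q T by (simp add: free_lift_superset[of _ ?T])
    finally show "free_lift R P \<phi> (p \<oplus>\<^bsub>F\<^esub> q) = free_lift R P \<phi> p \<oplus>\<^bsub>P\<^esub> free_lift R P \<phi> q" .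
  }
  fix a assume a: "a \<in> carrier R"
  have T: "finite (?s p)" "?s p \<subseteq> S" using p by (auto simp: free_module_carrier)
  have "?s (a \<odot>\<^bsub>F\<^esub> p) \<subseteq> ?s p" using a by (auto simp: free_module_simps)
  then have "free_lift R P \<phi> (a \<odot>\<^bsub>F\<^esub> p) = (\<Oplus>\<^bsub>P\<^esub>x\<in>?s p. (a \<odot>\<^bsub>F\<^esub> p) x \<odot>\<^bsub>P\<^esub> \<phi> x)"
    using p a T by (intro free_lift_superset) auto
  also have "\<dots> = (\<Oplus>\<^bsub>P\<^esub>x\<in>?s p. a \<odot>\<^bsub>P\<^esub> (p x \<odot>\<^bsub>P\<^esub> \<phi> x))"
    using p a T \<phi> by (intro P.finsum_cong')
      (auto simp: free_module_simps free_module_carrier Pi_def P.smult_assoc1 subset_iff)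
  also have "\<dots> = a \<odot>\<^bsub>P\<^esub> free_lift R P \<phi> p"
    unfolding free_lift_def using p a T by (simp add: P.finsum_smult_ldistr in_P)
  finally show "free_lift R P \<phi> (a \<odot>\<^bsub>F\<^esub> p) = a \<odot>\<^bsub>P\<^esub> free_lift R P \<phi> p" .
qed

lemma free_lift_gen:
  assumes "x \<in> S"
  shows "free_lift R P \<phi> (free_gen R x) = \<phi> x"
proof -
  interpret P: module R P by (rule P)
  have "free_lift R P \<phi> (free_gen R x) = (\<Oplus>\<^bsub>P\<^esub>y\<in>{x}. free_gen R x y \<odot>\<^bsub>P\<^esub> \<phi> y)"
    using assms by (intro free_lift_superset free_gen_carrier) (auto simp: free_gen_def)
  then show ?thesis using assms \<phi> by (simp add: free_gen_def Pi_def)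
qed

end

end

section \<open>Multilinear maps\<close>

text \<open>Linearity in each slot is phrased through list update, exactly as in
  \<open>multilinear_rels\<close>. The two families of relations then say that the slot map is
  additive and commutes with scalars.\<close>

definition multilinear ::
  "('a, 'r) ring_scheme \<Rightarrow> ('a, 'b, 'm) module_scheme \<Rightarrow> nat \<Rightarrow> ('a, 'c, 'n) module_scheme \<Rightarrow>
    ('b list \<Rightarrow> 'c) \<Rightarrow> bool"
  where "multilinear R M n N \<phi> \<longleftrightarrow> \<phi> \<in> tuples M n \<rightarrow> carrier N \<and>
    (\<forall>xs\<in>tuples M n. \<forall>i<n. (\<lambda>x. \<phi> (xs[i := x])) \<in> module_hom R M N)"

definition alternating ::
  "('b, 'm) ring_scheme \<Rightarrow> nat \<Rightarrow> ('c, 'n) ring_scheme \<Rightarrow> ('b list \<Rightarrow> 'c) \<Rightarrow> bool"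
  where "alternating M n N \<phi> \<longleftrightarrow>
    (\<forall>xs\<in>tuples M n. \<forall>i j. i < j \<and> j < n \<and> xs ! i = xs ! j \<longrightarrow> \<phi> xs = \<zero>\<^bsub>N\<^esub>)"

lemma tuples_update: "xs \<in> tuples M n \<Longrightarrow> x \<in> carrier M \<Longrightarrow> xs[i := x] \<in> tuples M n"
  using set_update_subset_insert by (fastforce simp: tuples_def)

lemma multilinear_closed: "multilinear R M n N \<phi> \<Longrightarrow> xs \<in> tuples M n \<Longrightarrow> \<phi> xs \<in> carrier N"
  by (auto simp: multilinear_def)

lemma multilinear_slot:
  "multilinear R M n N \<phi> \<Longrightarrow> xs \<in> tuples M n \<Longrightarrow> i < n \<Longrightarrow> (\<lambda>x. \<phi> (xs[i := x])) \<in> module_hom R M N"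
  by (auto simp: multilinear_def)

text \<open>Only the values on tuples count, so a form written with list operations can be exchanged
  for an explicit formula in its entries.\<close>

lemma multilinear_cong:
  assumes "module R M" "\<And>xs. xs \<in> tuples M n \<Longrightarrow> \<phi> xs = \<psi> xs"
  shows "multilinear R M n N \<phi> \<longleftrightarrow> multilinear R M n N \<psi>"
proof -
  have "(\<lambda>x. \<phi> (xs[i := x])) \<in> module_hom R M N \<longleftrightarrow> (\<lambda>x. \<psi> (xs[i := x])) \<in> module_hom R M N"
    if "xs \<in> tuples M n" for xs i
    by (rule module_hom_cong) (use assms that in \<open>auto intro: tuples_update\<close>)
  then show ?thesis using assms(2) by (auto simp: multilinear_def Pi_def)
qed

lemma multilinear_comp:
  assumes "multilinear R M n N \<phi>" "f \<in> module_hom R N P"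
  shows "multilinear R M n P (\<lambda>xs. f (\<phi> xs))"
  unfolding multilinear_def
  by (auto intro: module_hom_closed[OF assms(2)] multilinear_closed[OF assms(1)]
      module_hom_comp[OF multilinear_slot[OF assms(1)] assms(2)])

section \<open>Tensor powers\<close>

locale tensor_power_of = module R M for R (structure) and M (structure) + fixes n :: nat
begin

abbreviation "F \<equiv> free_module R (tuples M n)"
abbreviation "T \<equiv> tensor_power R M n"

sublocale free: free_module_on R "tuples M n" by unfold_locales

lemma multilinear_rels_carrier: "multilinear_rels R M n \<subseteq> carrier F"
proof -
  interpret F: module R F by (rule free.free_module_is_module)
  show ?thesis
    by (auto simp: multilinear_rels_def Let_def
        intro!: F.minus_closed F.a_closed F.smult_closed free.free_gen_carrier tuples_update)
qed

sublocale quot: quotient_by R F "tensor_null R M n"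
  unfolding tensor_null_def
  by (intro quotient_by.intro quotient_by_axioms.intro module_span_submodule
      free.free_module_is_module multilinear_rels_carrier)

lemma tensor_module: "module R T"
  unfolding tensor_power_def by (rule quot.quotient_module_is_module)

lemma tensor_eq: "xs \<in> tuples M n \<Longrightarrow> tensor R M xs = tensor_null R M n +>\<^bsub>F\<^esub> free_gen R xs"
  by (auto simp: tensor_def tuples_def)

lemma tensor_closed: "xs \<in> tuples M n \<Longrightarrow> tensor R M xs \<in> carrier T"
  using module_hom_closed[OF quot.coset_hom free.free_gen_carrier]
  by (simp add: tensor_eq tensor_power_def)

lemma tensor_span: "module_span R T (tensor R M ` tuples M n) = carrier T"
proof -
  have "tensor R M ` tuples M n = (\<lambda>p. tensor_null R M n +>\<^bsub>F\<^esub> p) ` free_gen R ` tuples M n"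
    by (auto simp: tensor_eq image_image)
  then show ?thesis
    unfolding tensor_power_def
    using quot.quotient_span[OF _ free.free_module_span] free.free_gen_carrier by auto
qed

lemma multilinear_rels_null: "r \<in> multilinear_rels R M n \<Longrightarrow> r \<in> tensor_null R M n"
  unfolding tensor_null_def by (rule subsetD[OF module_span_superset])

lemma tensor_multilinear: "multilinear R M n T (tensor R M)"
  unfolding multilinear_def
proof (intro conjI ballI allI impI)
  interpret F: module R F by (rule free.free_module_is_module)
  show "tensor R M \<in> tuples M n \<rightarrow> carrier T" using tensor_closed by auto
  fix xs i assume xs: "xs \<in> tuples M n" and i: "i < n"
  let ?g = "\<lambda>x. free_gen R (xs[i := x])"
  have g: "?g x \<in> carrier F" if "x \<in> carrier M" for x
    using xs that by (intro free.free_gen_carrier tuples_update)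
  have t: "tensor R M (xs[i := x]) = tensor_null R M n +>\<^bsub>F\<^esub> ?g x" if "x \<in> carrier M" for x
    using xs that by (intro tensor_eq tuples_update)
  show "(\<lambda>x. tensor R M (xs[i := x])) \<in> module_hom R M T"
  proof (rule module_homI)
    fix x assume x: "x \<in> carrier M"
    then show "tensor R M (xs[i := x]) \<in> carrier T" using xs by (intro tensor_closed tuples_update)
    {
      fix y assume y: "y \<in> carrier M"
      have "?g (x \<oplus>\<^bsub>M\<^esub> y) \<ominus>\<^bsub>F\<^esub> (?g x \<oplus>\<^bsub>F\<^esub> ?g y) \<in> tensor_null R M n"
        using xs i x y by (intro multilinear_rels_null) (auto simp: multilinear_rels_def Let_def)
      then show "tensor R M (xs[i := x \<oplus>\<^bsub>M\<^esub> y]) = tensor R M (xs[i := x]) \<oplus>\<^bsub>T\<^esub> tensor R M (xs[i := y])"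
        using x y g by (simp add: t tensor_power_def quot.add_quotient quot.coset_eq_iff)
    }
    fix a assume a: "a \<in> carrier R"
    have "?g (a \<odot>\<^bsub>M\<^esub> x) \<ominus>\<^bsub>F\<^esub> (a \<odot>\<^bsub>F\<^esub> ?g x) \<in> tensor_null R M n"
      using xs i x a by (intro multilinear_rels_null) (auto simp: multilinear_rels_def Let_def)
    then show "tensor R M (xs[i := a \<odot>\<^bsub>M\<^esub> x]) = a \<odot>\<^bsub>T\<^esub> tensor R M (xs[i := x])"
      using x a g by (simp add: t tensor_power_def quot.smult_quotient quot.coset_eq_iff)
  qed
qed

context
  fixes P :: "('a, 'e, 'n) module_scheme" and \<phi>
  assumes P: "module R P" and \<phi>: "multilinear R M n P \<phi>"
begin

text \<open>Each relation is sent to zero by linearity in the slot it concerns, and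
  \<open>tensor_null\<close> is the span of the relations.\<close>

lemma free_lift_null:
  assumes "p \<in> tensor_null R M n"
  shows "free_lift R P \<phi> p = \<zero>\<^bsub>P\<^esub>"
proof -
  interpret F: module R F by (rule free.free_module_is_module)
  interpret P: module R P by (rule P)
  have \<phi>': "\<phi> \<in> tuples M n \<rightarrow> carrier P" using \<phi> by (simp add: multilinear_def)
  note hom = free.free_lift_hom[OF P \<phi>']
  have eq: "free_lift R P \<phi> (free_gen R xs) = \<phi> xs" "free_gen R xs \<in> carrier F" "\<phi> xs \<in> carrier P"
    if "xs \<in> tuples M n" for xs
    using free.free_lift_gen[OF P \<phi>' that] free.free_gen_carrier[OF that] \<phi>' that by auto
  have "free_lift R P \<phi> r = \<zero>\<^bsub>P\<^esub>" if "r \<in> multilinear_rels R M n" for r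
    using that unfolding multilinear_rels_def Let_def
  proof (elim UnE CollectE exE conjE)
    fix xs i x y
    assume r: "r = free_gen R (xs[i := x \<oplus>\<^bsub>M\<^esub> y]) \<ominus>\<^bsub>F\<^esub> (free_gen R (xs[i := x]) \<oplus>\<^bsub>F\<^esub> free_gen R (xs[i := y]))"
      and xs: "xs \<in> tuples M n" and i: "i < n" and x: "x \<in> carrier M" and y: "y \<in> carrier M"
    show ?thesis
      using module_hom_add[OF multilinear_slot[OF \<phi> xs i] x y] eq tuples_update[OF xs] x y
      by (simp add: r module_hom_diff[OF free.free_module_is_module P hom] module_hom_add[OF hom]
          P.r_neg P.minus_eq)
  next
    fix xs i a x
    assume r: "r = free_gen R (xs[i := a \<odot>\<^bsub>M\<^esub> x]) \<ominus>\<^bsub>F\<^esub> (a \<odot>\<^bsub>F\<^esub> free_gen R (xs[i := x]))"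
      and xs: "xs \<in> tuples M n" and i: "i < n" and x: "x \<in> carrier M" and a: "a \<in> carrier R"
    show ?thesis
      using module_hom_smult[OF multilinear_slot[OF \<phi> xs i] a x] eq tuples_update[OF xs] x a
      by (simp add: r module_hom_diff[OF free.free_module_is_module P hom] module_hom_smult[OF hom]
          P.r_neg P.minus_eq)
  qed
  then show ?thesis
    using assms module_hom_eq_on_span[OF free.free_module_is_module P hom zero_module_hom[OF P] multilinear_rels_carrier]
    unfolding tensor_null_def by blast
qed

lemma tensor_lift_hom: "tensor_lift R P \<phi> \<in> module_hom R T P"
  unfolding tensor_lift_def tensor_power_def
  using \<phi> free_lift_null by (intro quot.induced_hom P free.free_lift_hom) (auto simp: multilinear_def)

lemma tensor_lift_tensor:
  assumes "xs \<in> tuples M n"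
  shows "tensor_lift R P \<phi> (tensor R M xs) = \<phi> xs"
proof -
  have \<phi>': "\<phi> \<in> tuples M n \<rightarrow> carrier P" using \<phi> by (simp add: multilinear_def)
  show ?thesis
    unfolding tensor_lift_def tensor_eq[OF assms]
    using quot.induced_coset[OF P free.free_lift_hom[OF P \<phi>'] free_lift_null
        free.free_gen_carrier[OF assms]] free.free_lift_gen[OF P \<phi>' assms] by simp
qed

end

end

text \<open>The uniqueness half of the universal property, since pure tensors span; existence is
  \<open>tensor_lift_hom\<close> together with \<open>tensor_lift_tensor\<close>.\<close>

lemma (in tensor_power_of) tensor_hom_eqI:
  assumes "module R P" "f \<in> module_hom R T P" "g \<in> module_hom R T P"
    and "\<And>xs. xs \<in> tuples M n \<Longrightarrow> f (tensor R M xs) = g (tensor R M xs)" "z \<in> carrier T"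
  shows "f z = g z"
  using module_hom_eq_on_span[OF tensor_module assms(1-3), of "tensor R M ` tuples M n" z]
    assms(4,5) tensor_closed tensor_span by auto

section \<open>Exterior powers and the symmetric square\<close>

locale ext_power_of = tensor_power_of R M n for R (structure) and M (structure) and n
begin

abbreviation "E \<equiv> ext_power R M n"

sublocale ext_quot: quotient_by R T "ext_null R M n"
  unfolding ext_null_def
  by (intro quotient_by.intro quotient_by_axioms.intro module_span_submodule tensor_module)
    (auto intro: tensor_closed)

lemma ext_module: "module R E"
  unfolding ext_power_def by (rule ext_quot.quotient_module_is_module)

lemma wedge_eq: "xs \<in> tuples M n \<Longrightarrow> wedge R M xs = ext_null R M n +>\<^bsub>T\<^esub> tensor R M xs"
  by (auto simp: wedge_def tuples_def)

lemma wedge_multilinear: "multilinear R M n E (wedge R M)"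
  unfolding ext_power_def
  by (rule iffD2[OF multilinear_cong[OF module_axioms]
        multilinear_comp[OF tensor_multilinear ext_quot.coset_hom]]) (rule wedge_eq)

lemma wedge_closed: "xs \<in> tuples M n \<Longrightarrow> wedge R M xs \<in> carrier E"
  using wedge_multilinear by (rule multilinear_closed)

lemma wedge_alternating: "alternating M n E (wedge R M)"
  unfolding alternating_def
proof (intro ballI allI impI)
  fix xs i j assume xs: "xs \<in> tuples M n" and ij: "i < j \<and> j < n \<and> xs ! i = xs ! j"
  then have "tensor R M xs \<in> ext_null R M n"
    unfolding ext_null_def by (intro subsetD[OF module_span_superset]) auto
  then show "wedge R M xs = \<zero>\<^bsub>E\<^esub>"
    using ext_quot.coset_eq_zero_iff[OF tensor_closed[OF xs]] by (simp add: wedge_eq xs ext_power_def)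
qed

lemma wedge_span: "module_span R E (wedge R M ` tuples M n) = carrier E"
proof -
  have "wedge R M ` tuples M n = (\<lambda>p. ext_null R M n +>\<^bsub>T\<^esub> p) ` tensor R M ` tuples M n"
    by (auto simp: wedge_eq image_image)
  then show ?thesis
    unfolding ext_power_def
    using ext_quot.quotient_span[OF _ tensor_span] tensor_closed by auto
qed

context
  fixes P :: "('a, 'e, 'n) module_scheme" and \<phi>
  assumes P: "module R P" and \<phi>: "multilinear R M n P \<phi>" and alt: "alternating M n P \<phi>"
begin

text \<open>On a pure tensor with a repeated entry the lift takes the value of
  \<open>\<phi>\<close>, which is zero by alternation; such tensors span
  \<open>ext_null\<close>.\<close>

lemma tensor_lift_ext_null:
  assumes "p \<in> ext_null R M n"
  shows "tensor_lift R P \<phi> p = \<zero>\<^bsub>P\<^esub>"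
  by (rule module_hom_eq_on_span[OF tensor_module P tensor_lift_hom[OF P \<phi>] zero_module_hom[OF P]
        _ _ assms[unfolded ext_null_def]])
    (use alt in \<open>auto simp: tensor_lift_tensor[OF P \<phi>] alternating_def intro: tensor_closed\<close>)

lemma ext_lift_hom: "ext_lift R P \<phi> \<in> module_hom R E P"
  unfolding ext_lift_def ext_power_def
  by (intro ext_quot.induced_hom P tensor_lift_hom \<phi> tensor_lift_ext_null)

lemma ext_lift_wedge: "xs \<in> tuples M n \<Longrightarrow> ext_lift R P \<phi> (wedge R M xs) = \<phi> xs"
  unfolding ext_lift_def
  using ext_quot.induced_coset[OF P tensor_lift_hom[OF P \<phi>] tensor_lift_ext_null tensor_closed]
  by (simp add: wedge_eq tensor_lift_tensor[OF P \<phi>])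

end

lemma ext_hom_eqI:
  assumes "module R P" "f \<in> module_hom R E P" "g \<in> module_hom R E P"
    and "\<And>xs. xs \<in> tuples M n \<Longrightarrow> f (wedge R M xs) = g (wedge R M xs)" "z \<in> carrier E"
  shows "f z = g z"
  using module_hom_eq_on_span[OF ext_module assms(1-3), of "wedge R M ` tuples M n" z]
    assms(4,5) wedge_closed wedge_span by auto

end

locale sym_square_of = tensor_power_of R M 2 for R (structure) and M (structure)
begin

abbreviation "S \<equiv> sym_square R M"

lemma tuples_2: "[x, y] \<in> tuples M 2 \<longleftrightarrow> x \<in> carrier M \<and> y \<in> carrier M"
  by (auto simp: tuples_def)

lemma tuples_2E:
  assumes "xs \<in> tuples M 2"
  obtains x y where "xs = [x, y]" "x \<in> carrier M" "y \<in> carrier M"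
  using assms by (auto simp: tuples_def numeral_2_eq_2 length_Suc_conv)

sublocale sym_quot: quotient_by R T "sym_null R M"
proof -
  interpret T: module R T by (rule tensor_module)
  show "quotient_by R T (sym_null R M)"
    unfolding sym_null_def
    by (intro quotient_by.intro quotient_by_axioms.intro module_span_submodule tensor_module)
      (auto intro!: T.minus_closed tensor_closed simp: tuples_2)
qed

lemma sym_module: "module R S"
  unfolding sym_square_def by (rule sym_quot.quotient_module_is_module)

lemma sym_prod_multilinear: "multilinear R M 2 S (\<lambda>xs. sym_prod R M (xs ! 0) (xs ! 1))"
proof -
  have "sym_prod R M (xs ! 0) (xs ! 1) = sym_null R M +>\<^bsub>T\<^esub> tensor R M xs" if "xs \<in> tuples M 2" for xs
    using that by (auto elim!: tuples_2E simp: sym_prod_def)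
  then show ?thesis
    unfolding sym_square_def
    by (rule iffD2[OF multilinear_cong[OF module_axioms]
          multilinear_comp[OF tensor_multilinear sym_quot.coset_hom]])
qed

lemma sym_prod_hom_left:
  assumes "y \<in> carrier M" shows "(\<lambda>x. sym_prod R M x y) \<in> module_hom R M S"
  using multilinear_slot[OF sym_prod_multilinear, of "[y, y]" 0] assms by (simp add: tuples_2)

lemma sym_prod_hom_right:
  assumes "x \<in> carrier M" shows "(\<lambda>y. sym_prod R M x y) \<in> module_hom R M S"
  using multilinear_slot[OF sym_prod_multilinear, of "[x, x]" 1] assms by (simp add: tuples_2)

lemma sym_prod_closed: "x \<in> carrier M \<Longrightarrow> y \<in> carrier M \<Longrightarrow> sym_prod R M x y \<in> carrier S"
  using sym_prod_hom_left by (rule module_hom_closed)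

lemma sym_prod_comm:
  assumes "x \<in> carrier M" "y \<in> carrier M"
  shows "sym_prod R M x y = sym_prod R M y x"
proof -
  have "tensor R M [x, y] \<ominus>\<^bsub>T\<^esub> tensor R M [y, x] \<in> sym_null R M"
    unfolding sym_null_def using assms by (intro subsetD[OF module_span_superset]) auto
  then show ?thesis
    using assms by (simp add: sym_prod_def sym_quot.coset_eq_iff tensor_closed tuples_2)
qed

lemma sym_prod_span: "module_span R S {sym_prod R M x y | x y. x \<in> carrier M \<and> y \<in> carrier M} = carrier S"
proof -
  have "{sym_prod R M x y | x y. x \<in> carrier M \<and> y \<in> carrier M}
      = (\<lambda>p. sym_null R M +>\<^bsub>T\<^esub> p) ` tensor R M ` tuples M 2"
    by (force elim!: tuples_2E simp: sym_prod_def image_image tuples_2)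
  then show ?thesis
    unfolding sym_square_def
    using sym_quot.quotient_span[OF _ tensor_span] tensor_closed by auto
qed

context
  fixes P :: "('a, 'e, 'n) module_scheme" and \<phi>
  assumes P: "module R P" and \<phi>: "multilinear R M 2 P \<phi>"
    and comm: "\<And>x y. x \<in> carrier M \<Longrightarrow> y \<in> carrier M \<Longrightarrow> \<phi> [x, y] = \<phi> [y, x]"
begin

lemma tensor_lift_sym_null:
  assumes "p \<in> sym_null R M"
  shows "tensor_lift R P \<phi> p = \<zero>\<^bsub>P\<^esub>"
proof -
  interpret P: module R P by (rule P)
  note hom = tensor_lift_hom[OF P \<phi>]
  have "tensor_lift R P \<phi> (tensor R M [x, y] \<ominus>\<^bsub>T\<^esub> tensor R M [y, x]) = \<zero>\<^bsub>P\<^esub>"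
    if "x \<in> carrier M" "y \<in> carrier M" for x y
    using that multilinear_closed[OF \<phi>, of "[y, x]"] comm[OF that]
    by (simp add: module_hom_diff[OF tensor_module P hom] tensor_closed tuples_2
        tensor_lift_tensor[OF P \<phi>] P.minus_eq P.r_neg)
  then show ?thesis
    by (intro module_hom_eq_on_span[OF tensor_module P hom zero_module_hom[OF P]
          _ _ assms[unfolded sym_null_def]]) (auto intro!: sym_quot.M.minus_closed tensor_closed simp: tuples_2)
qed

lemma sym_lift_hom: "sym_lift R P \<phi> \<in> module_hom R S P"
  unfolding sym_lift_def sym_square_def
  by (intro sym_quot.induced_hom P tensor_lift_hom \<phi> tensor_lift_sym_null)

lemma sym_lift_prod:
  assumes "x \<in> carrier M" "y \<in> carrier M"
  shows "sym_lift R P \<phi> (sym_prod R M x y) = \<phi> [x, y]"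
  unfolding sym_lift_def sym_prod_def
  using assms sym_quot.induced_coset[OF P tensor_lift_hom[OF P \<phi>] tensor_lift_sym_null tensor_closed]
  by (simp add: tensor_lift_tensor[OF P \<phi>] tuples_2)

end

lemma sym_hom_eqI:
  assumes "module R P" "f \<in> module_hom R S P" "g \<in> module_hom R S P"
    and "\<And>x y. x \<in> carrier M \<Longrightarrow> y \<in> carrier M \<Longrightarrow> f (sym_prod R M x y) = g (sym_prod R M x y)"
    and "s \<in> carrier S"
  shows "f s = g s"
  using module_hom_eq_on_span[OF sym_module assms(1-3),
      of "{sym_prod R M x y | x y. x \<in> carrier M \<and> y \<in> carrier M}" s]
    assms(4,5) sym_prod_closed sym_prod_span by auto

end

section \<open>Forms in two, three and four variables, and cancellation in abelian groups\<close>

lemma tuples_Cons: "x # xs \<in> tuples M (Suc n) \<longleftrightarrow> x \<in> carrier M \<and> xs \<in> tuples M n"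
  by (auto simp: tuples_def)

lemma tuples_Nil: "[] \<in> tuples M 0"
  by (simp add: tuples_def)

lemmas tuples_numeral = tuples_Cons tuples_Nil numeral_2_eq_2 numeral_3_eq_3 numeral_eq_Suc

lemma tuples_SucE:
  assumes "xs \<in> tuples M (Suc n)"
  obtains y ys where "xs = y # ys" "y \<in> carrier M" "ys \<in> tuples M n"
  using assms by (auto simp: tuples_def length_Suc_conv)

lemma tuples_0: "xs \<in> tuples M 0 \<longleftrightarrow> xs = []"
  by (auto simp: tuples_def)

lemma tuples_3E:
  assumes "xs \<in> tuples M 3"
  obtains x y z where "xs = [x, y, z]" "x \<in> carrier M" "y \<in> carrier M" "z \<in> carrier M"
  using assms by (auto simp: numeral_3_eq_3 tuples_0 elim!: tuples_SucE)

lemma tuples_4E: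
  assumes "xs \<in> tuples M 4"
  obtains x y z t where "xs = [x, y, z, t]"
    "x \<in> carrier M" "y \<in> carrier M" "z \<in> carrier M" "t \<in> carrier M"
  using assms by (auto simp: numeral_eq_Suc tuples_0 elim!: tuples_SucE)

text \<open>Unpacks lists of fixed length into variables, so that each slot condition can be met by
  composing known homomorphisms. Closure of the values in \<open>N\<close> already follows from one
  slot.\<close>

lemma multilinear_2I:
  assumes "module R M"
    and "\<And>y. y \<in> carrier M \<Longrightarrow> (\<lambda>x. \<phi> [x, y]) \<in> module_hom R M N"
    and "\<And>x. x \<in> carrier M \<Longrightarrow> (\<lambda>y. \<phi> [x, y]) \<in> module_hom R M N"
  shows "multilinear R M 2 N \<phi>"
proof -
  have "\<phi> [x, y] \<in> carrier N" if "x \<in> carrier M" "y \<in> carrier M" for x y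
    using module_hom_closed[OF assms(2)] that by blast
  then show ?thesis
    using assms unfolding multilinear_def
    by (auto simp: numeral_2_eq_2 tuples_0 less_Suc_eq elim!: tuples_SucE)
qed

lemma multilinear_3I:
  assumes "module R M"
    and "\<And>y z. y \<in> carrier M \<Longrightarrow> z \<in> carrier M \<Longrightarrow> (\<lambda>x. \<phi> [x, y, z]) \<in> module_hom R M N"
    and "\<And>x z. x \<in> carrier M \<Longrightarrow> z \<in> carrier M \<Longrightarrow> (\<lambda>y. \<phi> [x, y, z]) \<in> module_hom R M N"
    and "\<And>x y. x \<in> carrier M \<Longrightarrow> y \<in> carrier M \<Longrightarrow> (\<lambda>z. \<phi> [x, y, z]) \<in> module_hom R M N"
  shows "multilinear R M 3 N \<phi>"
proof -
  have "\<phi> [x, y, z] \<in> carrier N" if "x \<in> carrier M" "y \<in> carrier M" "z \<in> carrier M" for x y z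
    using module_hom_closed[OF assms(2)] that by blast
  then show ?thesis
    using assms unfolding multilinear_def
    by (auto simp: numeral_3_eq_3 tuples_0 less_Suc_eq elim!: tuples_SucE)
qed

lemma multilinear_4I:
  assumes "module R M"
    and "\<And>y z t. y \<in> carrier M \<Longrightarrow> z \<in> carrier M \<Longrightarrow> t \<in> carrier M \<Longrightarrow> (\<lambda>x. \<phi> [x, y, z, t]) \<in> module_hom R M N"
    and "\<And>x z t. x \<in> carrier M \<Longrightarrow> z \<in> carrier M \<Longrightarrow> t \<in> carrier M \<Longrightarrow> (\<lambda>y. \<phi> [x, y, z, t]) \<in> module_hom R M N"
    and "\<And>x y t. x \<in> carrier M \<Longrightarrow> y \<in> carrier M \<Longrightarrow> t \<in> carrier M \<Longrightarrow> (\<lambda>z. \<phi> [x, y, z, t]) \<in> module_hom R M N"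
    and "\<And>x y z. x \<in> carrier M \<Longrightarrow> y \<in> carrier M \<Longrightarrow> z \<in> carrier M \<Longrightarrow> (\<lambda>t. \<phi> [x, y, z, t]) \<in> module_hom R M N"
  shows "multilinear R M 4 N \<phi>"
proof -
  have "\<phi> [x, y, z, t] \<in> carrier N"
    if "x \<in> carrier M" "y \<in> carrier M" "z \<in> carrier M" "t \<in> carrier M" for x y z t
    using module_hom_closed[OF assms(2)] that by blast
  then show ?thesis
    using assms unfolding multilinear_def
    by (auto simp: numeral_eq_Suc tuples_0 less_Suc_eq elim!: tuples_SucE)
qed

lemma alternating_2I:
  assumes "\<And>x. x \<in> carrier M \<Longrightarrow> \<phi> [x, x] = \<zero>\<^bsub>N\<^esub>"
  shows "alternating M 2 N \<phi>"
  using assms unfolding alternating_def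
  by (auto simp: numeral_2_eq_2 tuples_0 less_Suc_eq elim!: tuples_SucE)

lemma alternating_3I:
  assumes "\<And>x y. x \<in> carrier M \<Longrightarrow> y \<in> carrier M \<Longrightarrow> \<phi> [x, x, y] = \<zero>\<^bsub>N\<^esub>"
    and "\<And>x y. x \<in> carrier M \<Longrightarrow> y \<in> carrier M \<Longrightarrow> \<phi> [x, y, x] = \<zero>\<^bsub>N\<^esub>"
    and "\<And>x y. x \<in> carrier M \<Longrightarrow> y \<in> carrier M \<Longrightarrow> \<phi> [y, x, x] = \<zero>\<^bsub>N\<^esub>"
  shows "alternating M 3 N \<phi>"
  using assms unfolding alternating_def
  by (auto simp: numeral_3_eq_3 tuples_0 less_Suc_eq elim!: tuples_SucE)

lemma alternating_4I:
  assumes "\<And>x y z. x \<in> carrier M \<Longrightarrow> y \<in> carrier M \<Longrightarrow> z \<in> carrier M \<Longrightarrow>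
      \<phi> [x, x, y, z] = \<zero>\<^bsub>N\<^esub> \<and> \<phi> [x, y, x, z] = \<zero>\<^bsub>N\<^esub> \<and> \<phi> [x, y, z, x] = \<zero>\<^bsub>N\<^esub> \<and>
      \<phi> [y, x, x, z] = \<zero>\<^bsub>N\<^esub> \<and> \<phi> [y, x, z, x] = \<zero>\<^bsub>N\<^esub> \<and> \<phi> [y, z, x, x] = \<zero>\<^bsub>N\<^esub>"
  shows "alternating M 4 N \<phi>"
  using assms unfolding alternating_def
  by (auto simp: numeral_eq_Suc tuples_0 less_Suc_eq elim!: tuples_SucE)

text \<open>Polarisation: in B(x + y, x + y) = 0 only the two mixed terms survive. The bracket,
  \<open>w2\<close>, and \<open>w3\<close> with its first entry fixed are the instances
  used.\<close>

lemma bilinear_alternating_swap: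
  assumes N: "module R N" and M: "module R M"
    and left: "\<And>y. y \<in> carrier M \<Longrightarrow> (\<lambda>x. B x y) \<in> module_hom R M N"
    and right: "\<And>x. x \<in> carrier M \<Longrightarrow> (\<lambda>y. B x y) \<in> module_hom R M N"
    and alt: "\<And>x. x \<in> carrier M \<Longrightarrow> B x x = \<zero>\<^bsub>N\<^esub>"
    and x: "x \<in> carrier M" and y: "y \<in> carrier M"
  shows "B y x = \<ominus>\<^bsub>N\<^esub> B x y"
proof -
  interpret N: module R N by fact
  interpret M: module R M by fact
  have closed: "B u v \<in> carrier N" if "u \<in> carrier M" "v \<in> carrier M" for u v
    using module_hom_closed[OF left] that by blast
  have "B (x \<oplus>\<^bsub>M\<^esub> y) (x \<oplus>\<^bsub>M\<^esub> y) = B y x \<oplus>\<^bsub>N\<^esub> B x y"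
    using x y closed alt[OF x] alt[OF y]
    by (simp add: module_hom_add[OF left] module_hom_add[OF right] N.a_comm)
  then have "B y x \<oplus>\<^bsub>N\<^esub> B x y = \<zero>\<^bsub>N\<^esub>"
    using closed x y alt[of "x \<oplus>\<^bsub>M\<^esub> y"] by simp
  then show ?thesis using closed x y by (simp add: N.minus_equality)
qed

text \<open>Cancellation at a distance, complementing \<open>r_neg1\<close> and \<open>r_neg2\<close> in sums normalised by \<open>a_ac\<close>.\<close>

context abelian_group
begin

lemma neg_zero: "\<ominus> \<zero> = \<zero>"
  by (rule minus_equality) simp_all

lemma neg_cancel:
  assumes "x \<in> carrier G" "a \<in> carrier G"
  shows "x \<oplus> (a \<oplus> \<ominus> x) = a" "\<ominus> x \<oplus> (a \<oplus> x) = a"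
    and "b \<in> carrier G \<Longrightarrow> x \<oplus> (a \<oplus> (\<ominus> x \<oplus> b)) = a \<oplus> b"
    and "b \<in> carrier G \<Longrightarrow> \<ominus> x \<oplus> (a \<oplus> (x \<oplus> b)) = a \<oplus> b"
    and "b \<in> carrier G \<Longrightarrow> c \<in> carrier G \<Longrightarrow> x \<oplus> (a \<oplus> (b \<oplus> (\<ominus> x \<oplus> c))) = a \<oplus> (b \<oplus> c)"
  using assms
  by (simp_all add: a_lcomm[of x a] a_lcomm[of x b] a_lcomm[of "\<ominus> x" a] a_comm[of a "\<ominus> x"] a_comm[of a x]
      r_neg1 r_neg2)

lemmas abelian_simps = minus_eq minus_add minus_minus a_ac r_neg l_neg r_neg1 r_neg2 neg_cancel neg_zero

end

lemma (in abelian_group) eq_add_of_add_neg: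
  assumes "p \<in> carrier G" "q \<in> carrier G" "r \<in> carrier G" "p \<oplus> \<ominus> q \<oplus> r = \<zero>"
  shows "q = p \<oplus> r"
  using minus_equality[of "p \<oplus> r" "\<ominus> q"] assms by (simp add: a_ac)

text \<open>
  The shape of \<open>\<partial>\<^sub>3 \<partial>\<^sub>4 (x \<and> y \<and> z \<and> t)\<close>: four Jacobi triples and three cancelling pairs.
\<close>

lemma (in abelian_group) regroup_18:
  assumes [simp]: "a1 \<in> carrier G" "a2 \<in> carrier G" "a3 \<in> carrier G" "b1 \<in> carrier G" "b2 \<in> carrier G" "b3 \<in> carrier G"
    "c1 \<in> carrier G" "c2 \<in> carrier G" "c3 \<in> carrier G" "d1 \<in> carrier G" "d2 \<in> carrier G" "d3 \<in> carrier G"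
    "p \<in> carrier G" "q \<in> carrier G" "r \<in> carrier G"
    and zero: "a1 \<oplus> \<ominus> a2 \<oplus> a3 = \<zero>" "b1 \<oplus> \<ominus> b2 \<oplus> b3 = \<zero>" "c1 \<oplus> \<ominus> c2 \<oplus> c3 = \<zero>" "d1 \<oplus> \<ominus> d2 \<oplus> d3 = \<zero>"
  shows "\<ominus> (\<ominus> a1 \<oplus> (b1 \<oplus> \<ominus> p)) \<oplus> ((\<ominus> a2 \<oplus> (c1 \<oplus> \<ominus> q)) \<oplus> (\<ominus> (\<ominus> b2 \<oplus> (c2 \<oplus> \<ominus> r)) \<oplus>
    (\<ominus> (\<ominus> a3 \<oplus> (d1 \<oplus> r)) \<oplus> ((\<ominus> b3 \<oplus> (d2 \<oplus> q)) \<oplus> \<ominus> (\<ominus> c3 \<oplus> (d3 \<oplus> p)))))) = \<zero>"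
    (is "?l = _")
proof -
  have "?l = (a1 \<oplus> \<ominus> a2 \<oplus> a3) \<oplus> \<ominus> (b1 \<oplus> \<ominus> b2 \<oplus> b3) \<oplus> (c1 \<oplus> \<ominus> c2 \<oplus> c3) \<oplus> \<ominus> (d1 \<oplus> \<ominus> d2 \<oplus> d3)
      \<oplus> (p \<oplus> \<ominus> p) \<oplus> (q \<oplus> \<ominus> q) \<oplus> (r \<oplus> \<ominus> r)"
    by (simp add: minus_add minus_minus a_ac del: r_neg)
  then show ?thesis by (simp add: zero r_neg neg_zero)
qed

section \<open>The Chevalley--Eilenberg complex in low degrees\<close>

context lie_algebra
begin

sublocale E2: ext_power_of R L 2 by unfold_locales
sublocale E3: ext_power_of R L 3 by unfold_locales
sublocale E4: ext_power_of R L 4 by unfold_locales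
sublocale S: sym_square_of R L by unfold_locales
sublocale ME2: module R "ext_power R L 2" by (rule E2.ext_module)
sublocale ME3: module R "ext_power R L 3" by (rule E3.ext_module)
sublocale ME4: module R "ext_power R L 4" by (rule E4.ext_module)
sublocale MS: module R "sym_square R L" by (rule S.sym_module)

abbreviation br where "br \<equiv> bracket L"
abbreviation w2 where "w2 x y \<equiv> wedge R L [x, y]"
abbreviation w3 where "w3 x y z \<equiv> wedge R L [x, y, z]"
abbreviation w4 where "w4 x y z t \<equiv> wedge R L [x, y, z, t]"

declare bracket_closed [simp, intro]

lemma bracket_hom_left: "y \<in> carrier L \<Longrightarrow> (\<lambda>x. br x y) \<in> module_hom R L L"
  by (rule module_homI) (auto simp: bracket_add_left bracket_smult_left)

lemma bracket_hom_right: "x \<in> carrier L \<Longrightarrow> (\<lambda>y. br x y) \<in> module_hom R L L"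
  by (rule module_homI) (auto simp: bracket_add_right bracket_smult_right)

lemma bracket_swap: "x \<in> carrier L \<Longrightarrow> y \<in> carrier L \<Longrightarrow> br y x = \<ominus>\<^bsub>L\<^esub> br x y"
  by (rule bilinear_alternating_swap[OF module_axioms module_axioms bracket_hom_left bracket_hom_right bracket_self])

text \<open>The left-nested shape is the one in which double brackets arise when the boundary is
  applied twice. By antisymmetry the sum is the negative of the cyclic Jacobi sum.\<close>

lemma jacobi_left:
  assumes "x \<in> carrier L" "y \<in> carrier L" "z \<in> carrier L"
  shows "br (br x y) z \<oplus>\<^bsub>L\<^esub> \<ominus>\<^bsub>L\<^esub> br (br x z) y \<oplus>\<^bsub>L\<^esub> br (br y z) x = \<zero>\<^bsub>L\<^esub>"
proof -
  have "br (br x y) z \<oplus>\<^bsub>L\<^esub> \<ominus>\<^bsub>L\<^esub> br (br x z) y \<oplus>\<^bsub>L\<^esub> br (br y z) x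
    = \<ominus>\<^bsub>L\<^esub> (br x (br y z) \<oplus>\<^bsub>L\<^esub> br y (br z x) \<oplus>\<^bsub>L\<^esub> br z (br x y))"
    using assms
    by (simp add: bracket_swap[of z "br x y"] bracket_swap[of y "br x z"] bracket_swap[of x "br y z"]
        bracket_swap[of x z] module_hom_neg[OF module_axioms module_axioms bracket_hom_right]
        M.minus_add M.a_ac)
  then show ?thesis using assms jacobi by simp
qed

lemma w2_closed [simp, intro]: "x \<in> carrier L \<Longrightarrow> y \<in> carrier L \<Longrightarrow> w2 x y \<in> carrier (ext_power R L 2)"
  by (rule E2.wedge_closed) (simp add: tuples_numeral)

lemma w3_closed [simp, intro]:
  "x \<in> carrier L \<Longrightarrow> y \<in> carrier L \<Longrightarrow> z \<in> carrier L \<Longrightarrow> w3 x y z \<in> carrier (ext_power R L 3)"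
  by (rule E3.wedge_closed) (simp add: tuples_numeral)

lemma w2_hom:
  assumes "y \<in> carrier L"
  shows "(\<lambda>x. w2 x y) \<in> module_hom R L (ext_power R L 2)"
    and "(\<lambda>x. w2 y x) \<in> module_hom R L (ext_power R L 2)"
  using multilinear_slot[OF E2.wedge_multilinear, of "[y, y]" 0]
    multilinear_slot[OF E2.wedge_multilinear, of "[y, y]" 1] assms
  by (simp_all add: tuples_numeral)

lemma w3_hom:
  assumes "y \<in> carrier L" "z \<in> carrier L"
  shows "(\<lambda>x. w3 x y z) \<in> module_hom R L (ext_power R L 3)"
    and "(\<lambda>x. w3 y x z) \<in> module_hom R L (ext_power R L 3)"
    and "(\<lambda>x. w3 y z x) \<in> module_hom R L (ext_power R L 3)"
  using multilinear_slot[OF E3.wedge_multilinear, of "[y, y, z]" 0]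
    multilinear_slot[OF E3.wedge_multilinear, of "[y, y, z]" 1]
    multilinear_slot[OF E3.wedge_multilinear, of "[y, z, y]" 2] assms
  by (simp_all add: tuples_numeral)

lemma w2_self: "x \<in> carrier L \<Longrightarrow> w2 x x = \<zero>\<^bsub>ext_power R L 2\<^esub>"
  using E2.wedge_alternating[unfolded alternating_def, rule_format, of "[x, x]" 0 1]
  by (simp add: tuples_numeral)

lemma w3_self:
  assumes "x \<in> carrier L" "y \<in> carrier L"
  shows "w3 x x y = \<zero>\<^bsub>ext_power R L 3\<^esub>" "w3 x y x = \<zero>\<^bsub>ext_power R L 3\<^esub>" "w3 y x x = \<zero>\<^bsub>ext_power R L 3\<^esub>"
  using E3.wedge_alternating[unfolded alternating_def, rule_format, of "[x, x, y]" 0 1]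
    E3.wedge_alternating[unfolded alternating_def, rule_format, of "[x, y, x]" 0 2]
    E3.wedge_alternating[unfolded alternating_def, rule_format, of "[y, x, x]" 1 2] assms
  by (simp_all add: tuples_numeral)

lemma w2_swap: "x \<in> carrier L \<Longrightarrow> y \<in> carrier L \<Longrightarrow> w2 y x = \<ominus>\<^bsub>ext_power R L 2\<^esub> w2 x y"
  by (rule bilinear_alternating_swap[OF ME2.module_axioms module_axioms w2_hom w2_self])

lemma w3_swap:
  assumes "a \<in> carrier L" "x \<in> carrier L" "y \<in> carrier L"
  shows "w3 a y x = \<ominus>\<^bsub>ext_power R L 3\<^esub> w3 a x y"
  by (rule bilinear_alternating_swap[OF ME3.module_axioms module_axioms, where B = "w3 a"])
    (use assms in \<open>simp_all add: w3_hom w3_self\<close>)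

lemmas w2_neg = module_hom_neg[OF module_axioms ME2.module_axioms w2_hom(1)]
lemmas w3_neg = module_hom_neg[OF module_axioms ME3.module_axioms w3_hom(1)]
lemmas w2_zero = module_hom_zero[OF module_axioms ME2.module_axioms w2_hom(1)]
lemmas w3_zero = module_hom_zero[OF module_axioms ME3.module_axioms w3_hom(1)]

lemmas w2_bracket_hom = module_hom_comp[OF bracket_hom_left w2_hom(1)] module_hom_comp[OF bracket_hom_right w2_hom(1)]
lemmas w3_bracket_hom = module_hom_comp[OF bracket_hom_left w3_hom(1)] module_hom_comp[OF bracket_hom_right w3_hom(1)]

lemmas pointwise_homs = module_hom_add_pointwise module_hom_neg_pointwise

text \<open>The function lifted inside \<open>ce_boundary\<close>, isolated because the lift is
  usable only after this function is known to be multilinear and alternating.\<close>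

definition ce_boundary_form where
  "ce_boundary_form n xs = finsum (ext_power R L (n - 1))
        (\<lambda>(i, j). ((\<ominus>\<^bsub>R\<^esub> \<one>\<^bsub>R\<^esub>) [^]\<^bsub>R\<^esub> (i + j)) \<odot>\<^bsub>ext_power R L (n - 1)\<^esub>
          wedge R L (br (xs ! i) (xs ! j) # nths xs (- {i, j})))
        {(i, j). i < j \<and> j < n}"

lemma ce_boundary_eq: "ce_boundary R L n = ext_lift R (ext_power R L (n - 1)) (ce_boundary_form n)"
  by (simp add: ce_boundary_def ce_boundary_form_def[abs_def] Let_def)

text \<open>The exponents 2 to 5 are the sums i + j beyond 1 that occur for at most four entries
  counted from 0.\<close>

lemma sign_powers:
  "(\<ominus>\<^bsub>R\<^esub> \<one>\<^bsub>R\<^esub>) [^]\<^bsub>R\<^esub> (2::nat) = \<one>\<^bsub>R\<^esub>" "(\<ominus>\<^bsub>R\<^esub> \<one>\<^bsub>R\<^esub>) [^]\<^bsub>R\<^esub> (3::nat) = \<ominus>\<^bsub>R\<^esub> \<one>\<^bsub>R\<^esub>"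
  "(\<ominus>\<^bsub>R\<^esub> \<one>\<^bsub>R\<^esub>) [^]\<^bsub>R\<^esub> (4::nat) = \<one>\<^bsub>R\<^esub>" "(\<ominus>\<^bsub>R\<^esub> \<one>\<^bsub>R\<^esub>) [^]\<^bsub>R\<^esub> (5::nat) = \<ominus>\<^bsub>R\<^esub> \<one>\<^bsub>R\<^esub>"
  by (simp_all add: numeral_eq_Suc R.l_minus R.r_minus)

lemma pairs_3: "{(i, j). i < j \<and> j < (3::nat)} = {(0, 1), (0, 2), (1, 2)}"
  by (auto simp: numeral_eq_Suc less_Suc_eq)

lemma pairs_4: "{(i, j). i < j \<and> j < (4::nat)} = {(0, 1), (0, 2), (0, 3), (1, 2), (1, 3), (2, 3)}"
  by (auto simp: numeral_eq_Suc less_Suc_eq)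

lemma nths_3:
  "nths [x, y, z] (- {0, 1}) = [z]" "nths [x, y, z] (- {0, 2}) = [y]" "nths [x, y, z] (- {1, 2}) = [x]"
  by (simp_all add: nths_Cons numeral_eq_Suc)

lemma nths_4:
  "nths [x, y, z, t] (- {0, 1}) = [z, t]" "nths [x, y, z, t] (- {0, 2}) = [y, t]"
  "nths [x, y, z, t] (- {0, 3}) = [y, z]" "nths [x, y, z, t] (- {1, 2}) = [x, t]"
  "nths [x, y, z, t] (- {1, 3}) = [x, z]" "nths [x, y, z, t] (- {2, 3}) = [x, y]"
  by (simp_all add: nths_Cons numeral_eq_Suc)

lemma ce_boundary_form_3:
  assumes "x \<in> carrier L" "y \<in> carrier L" "z \<in> carrier L"
  shows "ce_boundary_form 3 [x, y, z] = \<ominus>\<^bsub>E2.E\<^esub> w2 (br x y) z \<oplus>\<^bsub>E2.E\<^esub> (w2 (br x z) y \<oplus>\<^bsub>E2.E\<^esub>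
    \<ominus>\<^bsub>E2.E\<^esub> w2 (br y z) x)"
proof -
  show ?thesis
    using assms nths_3[of x y z] unfolding ce_boundary_form_def pairs_3
    by (simp add: ME2.smult_l_minus sign_powers)
qed

lemma ce_boundary_form_4:
  assumes "x \<in> carrier L" "y \<in> carrier L" "z \<in> carrier L" "t \<in> carrier L"
  shows "ce_boundary_form 4 [x, y, z, t] = \<ominus>\<^bsub>E3.E\<^esub> w3 (br x y) z t \<oplus>\<^bsub>E3.E\<^esub> (w3 (br x z) y t \<oplus>\<^bsub>E3.E\<^esub>
    (\<ominus>\<^bsub>E3.E\<^esub> w3 (br x t) y z \<oplus>\<^bsub>E3.E\<^esub> (\<ominus>\<^bsub>E3.E\<^esub> w3 (br y z) x t \<oplus>\<^bsub>E3.E\<^esub>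
    (w3 (br y t) x z \<oplus>\<^bsub>E3.E\<^esub> \<ominus>\<^bsub>E3.E\<^esub> w3 (br z t) x y))))"
proof -
  show ?thesis
    using assms nths_4[of x y z t] unfolding ce_boundary_form_def pairs_4
    by (simp add: ME3.smult_l_minus sign_powers R.l_minus R.r_minus)
qed

lemma ce_boundary_form_3_multilinear: "multilinear R L 3 E2.E (ce_boundary_form 3)"
proof -
  \<comment> \<open>The expanded formula replaces the finite sum because each of its terms is, in
    every variable, a composite of a bracket map with a wedge map or a wedge map alone.\<close>
  let ?f = "\<lambda>x y z. \<ominus>\<^bsub>E2.E\<^esub> w2 (br x y) z \<oplus>\<^bsub>E2.E\<^esub> (w2 (br x z) y \<oplus>\<^bsub>E2.E\<^esub> \<ominus>\<^bsub>E2.E\<^esub> w2 (br y z) x)"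
  have "multilinear R L 3 E2.E (\<lambda>xs. ?f (xs ! 0) (xs ! 1) (xs ! 2))"
    by (rule multilinear_3I[OF module_axioms])
      (simp_all add: pointwise_homs ME2.module_axioms w2_bracket_hom w2_hom)
  then show ?thesis
    by (rule iffD2[OF multilinear_cong[OF module_axioms], rotated])
      (auto elim!: tuples_3E simp: ce_boundary_form_3 simp del: One_nat_def)
qed

text \<open>If two entries are equal, the term with their bracket is zero, and the other two terms
  cancel, after a swap inside the bracket if necessary.\<close>

lemma ce_boundary_form_3_alternating: "alternating L 3 E2.E (ce_boundary_form 3)"
proof (rule alternating_3I)
  fix x y assume [simp]: "x \<in> carrier L" "y \<in> carrier L"
  have swap: "br y x = \<ominus>\<^bsub>L\<^esub> br x y" by (rule bracket_swap) auto
  show "ce_boundary_form 3 [x, x, y] = \<zero>\<^bsub>E2.E\<^esub>" "ce_boundary_form 3 [x, y, x] = \<zero>\<^bsub>E2.E\<^esub>"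
    "ce_boundary_form 3 [y, x, x] = \<zero>\<^bsub>E2.E\<^esub>"
    by (simp_all add: ce_boundary_form_3 bracket_self w2_self w2_zero w2_neg swap ME2.l_neg ME2.r_neg ME2.neg_zero)
qed

lemma ce_boundary_form_4_multilinear: "multilinear R L 4 E3.E (ce_boundary_form 4)"
proof -
  let ?f = "\<lambda>x y z t. \<ominus>\<^bsub>E3.E\<^esub> w3 (br x y) z t \<oplus>\<^bsub>E3.E\<^esub> (w3 (br x z) y t \<oplus>\<^bsub>E3.E\<^esub>
    (\<ominus>\<^bsub>E3.E\<^esub> w3 (br x t) y z \<oplus>\<^bsub>E3.E\<^esub> (\<ominus>\<^bsub>E3.E\<^esub> w3 (br y z) x t \<oplus>\<^bsub>E3.E\<^esub>
    (w3 (br y t) x z \<oplus>\<^bsub>E3.E\<^esub> \<ominus>\<^bsub>E3.E\<^esub> w3 (br z t) x y))))"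
  have "multilinear R L 4 E3.E (\<lambda>xs. ?f (xs ! 0) (xs ! 1) (xs ! 2) (xs ! 3))"
    by (rule multilinear_4I[OF module_axioms])
      (simp_all add: pointwise_homs ME3.module_axioms w3_bracket_hom w3_hom)
  then show ?thesis
    by (rule iffD2[OF multilinear_cong[OF module_axioms], rotated])
      (auto elim!: tuples_4E simp: ce_boundary_form_4 simp del: One_nat_def)
qed

text \<open>Of the six terms, one contains the bracket of the equal entries and one keeps both of
  them in the wedge, so these vanish. The remaining four cancel in pairs after reordering brackets
  and wedges.\<close>

lemma ce_boundary_form_4_alternating: "alternating L 4 E3.E (ce_boundary_form 4)"
proof (rule alternating_4I)
  fix x y z assume [simp]: "x \<in> carrier L" "y \<in> carrier L" "z \<in> carrier L"
  have swap: "br y x = \<ominus>\<^bsub>L\<^esub> br x y" "br z x = \<ominus>\<^bsub>L\<^esub> br x z" "br z y = \<ominus>\<^bsub>L\<^esub> br y z"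
    by (rule bracket_swap; simp)+
  have swap3: "w3 a y x = \<ominus>\<^bsub>E3.E\<^esub> w3 a x y" "w3 a z x = \<ominus>\<^bsub>E3.E\<^esub> w3 a x z" "w3 a z y = \<ominus>\<^bsub>E3.E\<^esub> w3 a y z"
    if "a \<in> carrier L" for a
    by (rule w3_swap; simp add: that)+
  show "ce_boundary_form 4 [x, x, y, z] = \<zero>\<^bsub>E3.E\<^esub> \<and> ce_boundary_form 4 [x, y, x, z] = \<zero>\<^bsub>E3.E\<^esub> \<and>
     ce_boundary_form 4 [x, y, z, x] = \<zero>\<^bsub>E3.E\<^esub> \<and> ce_boundary_form 4 [y, x, x, z] = \<zero>\<^bsub>E3.E\<^esub> \<and>
     ce_boundary_form 4 [y, x, z, x] = \<zero>\<^bsub>E3.E\<^esub> \<and> ce_boundary_form 4 [y, z, x, x] = \<zero>\<^bsub>E3.E\<^esub>"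
    by (simp add: ce_boundary_form_4 bracket_self w3_self w3_zero w3_neg swap swap3 ME3.abelian_simps)
qed

abbreviation "d3 \<equiv> ce_boundary R L 3"
abbreviation "d4 \<equiv> ce_boundary R L 4"

lemma d3_hom: "d3 \<in> module_hom R E3.E E2.E"
  using E3.ext_lift_hom[OF ME2.module_axioms ce_boundary_form_3_multilinear ce_boundary_form_3_alternating]
  by (simp add: ce_boundary_eq)

lemma d4_hom: "d4 \<in> module_hom R E4.E E3.E"
  using E4.ext_lift_hom[OF ME3.module_axioms ce_boundary_form_4_multilinear ce_boundary_form_4_alternating]
  by (simp add: ce_boundary_eq)

lemma d3_wedge:
  assumes "x \<in> carrier L" "y \<in> carrier L" "z \<in> carrier L"
  shows "d3 (w3 x y z) = \<ominus>\<^bsub>E2.E\<^esub> w2 (br x y) z \<oplus>\<^bsub>E2.E\<^esub> (w2 (br x z) y \<oplus>\<^bsub>E2.E\<^esub> \<ominus>\<^bsub>E2.E\<^esub> w2 (br y z) x)"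
proof -
  have "[x, y, z] \<in> tuples L 3" using assms by (simp add: tuples_numeral)
  then show ?thesis
    using E3.ext_lift_wedge[OF ME2.module_axioms ce_boundary_form_3_multilinear ce_boundary_form_3_alternating]
      ce_boundary_form_3[OF assms] by (simp add: ce_boundary_eq)
qed

lemma d4_wedge:
  assumes "x \<in> carrier L" "y \<in> carrier L" "z \<in> carrier L" "t \<in> carrier L"
  shows "d4 (w4 x y z t) = \<ominus>\<^bsub>E3.E\<^esub> w3 (br x y) z t \<oplus>\<^bsub>E3.E\<^esub> (w3 (br x z) y t \<oplus>\<^bsub>E3.E\<^esub>
    (\<ominus>\<^bsub>E3.E\<^esub> w3 (br x t) y z \<oplus>\<^bsub>E3.E\<^esub> (\<ominus>\<^bsub>E3.E\<^esub> w3 (br y z) x t \<oplus>\<^bsub>E3.E\<^esub>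
    (w3 (br y t) x z \<oplus>\<^bsub>E3.E\<^esub> \<ominus>\<^bsub>E3.E\<^esub> w3 (br z t) x y))))"
proof -
  have "[x, y, z, t] \<in> tuples L 4" using assms by (simp add: tuples_numeral)
  then show ?thesis
    using E4.ext_lift_wedge[OF ME3.module_axioms ce_boundary_form_4_multilinear ce_boundary_form_4_alternating]
      ce_boundary_form_4[OF assms] by (simp add: ce_boundary_eq)
qed

end

section \<open>The complex property in degree three, and third homology as a quotient module\<close>

context lie_algebra
begin

lemma w2_jacobi:
  assumes [simp]: "x \<in> carrier L" "y \<in> carrier L" "z \<in> carrier L" "t \<in> carrier L"
  shows "w2 (br (br x y) z) t \<oplus>\<^bsub>E2.E\<^esub> \<ominus>\<^bsub>E2.E\<^esub> w2 (br (br x z) y) t \<oplus>\<^bsub>E2.E\<^esub> w2 (br (br y z) x) t = \<zero>\<^bsub>E2.E\<^esub>"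
proof -
  have "w2 (br (br x y) z \<oplus>\<^bsub>L\<^esub> \<ominus>\<^bsub>L\<^esub> br (br x z) y \<oplus>\<^bsub>L\<^esub> br (br y z) x) t = \<zero>\<^bsub>E2.E\<^esub>"
    by (simp add: jacobi_left w2_zero)
  then show ?thesis by (simp add: module_hom_add[OF w2_hom(1)] w2_neg)
qed

lemma d3_d4:
  assumes "v \<in> carrier E4.E"
  shows "d3 (d4 v) = \<zero>\<^bsub>E2.E\<^esub>"
proof (rule E4.ext_hom_eqI[OF ME2.module_axioms module_hom_comp[OF d4_hom d3_hom] zero_module_hom[OF ME2.module_axioms] _ assms])
  fix xs assume "xs \<in> tuples L 4"
  then obtain x y z t where xs: "xs = [x, y, z, t]"
    and [simp]: "x \<in> carrier L" "y \<in> carrier L" "z \<in> carrier L" "t \<in> carrier L"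
    by (rule tuples_4E)
  \<comment> \<open>Each wedge of two brackets occurs in both orders. Writing one order as the
    negative of the other produces the three cancelling pairs of \<open>regroup_18\<close>; the four
    vanishing triples come from \<open>w2_jacobi\<close>.\<close>
  have swap: "w2 (br x t) (br y z) = \<ominus>\<^bsub>E2.E\<^esub> w2 (br y z) (br x t)"
    "w2 (br x z) (br y t) = \<ominus>\<^bsub>E2.E\<^esub> w2 (br y t) (br x z)"
    "w2 (br x y) (br z t) = \<ominus>\<^bsub>E2.E\<^esub> w2 (br z t) (br x y)"
    by (simp_all add: w2_swap[symmetric])
  show "d3 (d4 (wedge R L xs)) = \<zero>\<^bsub>E2.E\<^esub>"
    by (simp add: xs d4_wedge module_hom_add[OF d3_hom] module_hom_neg[OF ME3.module_axioms ME2.module_axioms d3_hom]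
        d3_wedge swap ME2.regroup_18 w2_jacobi)
qed

lemma cycles_submodule: "submodule (ce_cycles R L 3) R E3.E"
  using submodule_kernel[OF ME3.module_axioms ME2.module_axioms d3_hom] by (simp add: ce_cycles_def)

lemma boundaries_submodule: "submodule (ce_boundaries R L 3) R E3.E"
  using submodule_image[OF ME4.module_axioms ME3.module_axioms d4_hom] by (simp add: ce_boundaries_def)

lemma mem_cycles: "z \<in> ce_cycles R L 3 \<longleftrightarrow> z \<in> carrier E3.E \<and> d3 z = \<zero>\<^bsub>E2.E\<^esub>"
  by (simp add: ce_cycles_def a_kernel_def')

lemma mem_boundaries: "z \<in> ce_boundaries R L 3 \<longleftrightarrow> (\<exists>v\<in>carrier E4.E. z = d4 v)"
  by (auto simp: ce_boundaries_def)

lemma boundaries_subset_cycles: "ce_boundaries R L 3 \<subseteq> ce_cycles R L 3"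
  using module_hom_closed[OF d4_hom] by (auto simp: mem_cycles mem_boundaries d3_d4)

text \<open>Cycles are kept as the record of the exterior power with a smaller carrier. That the
  boundaries form a submodule of it rests on \<open>d3_d4\<close>.\<close>

sublocale H: quotient_by R "(ext_power R L 3)\<lparr>carrier := ce_cycles R L 3\<rparr>" "ce_boundaries R L 3"
  by (intro quotient_by.intro quotient_by_axioms.intro submodule.submodule_is_module[OF cycles_submodule]
      submodule_of_submodule ME3.module_axioms cycles_submodule boundaries_submodule boundaries_subset_cycles)

text \<open>A coset depends only on addition, which restricting the carrier does not change; so
  classes formed in the exterior power are cosets in the module of cycles.\<close>

lemma homology_class_eq:
  "homology_class R L 3 z = ce_boundaries R L 3 +>\<^bsub>(ext_power R L 3)\<lparr>carrier := ce_cycles R L 3\<rparr>\<^esub> z"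
  by (simp add: homology_class_def a_r_coset_carrier)

lemma homology_module: "module R (ce_homology R L 3)"
  unfolding ce_homology_def by (rule H.quotient_module_is_module)

lemma homology_carrier: "carrier (ce_homology R L 3) = homology_class R L 3 ` ce_cycles R L 3"
  unfolding ce_homology_def homology_class_eq using H.carrier_quotient by simp

lemma homology_class_hom:
  "homology_class R L 3 \<in> module_hom R (E3.E\<lparr>carrier := ce_cycles R L 3\<rparr>) (ce_homology R L 3)"
  using H.coset_hom unfolding ce_homology_def homology_class_eq[abs_def] .

lemma homology_class_zero: "z \<in> ce_boundaries R L 3 \<Longrightarrow> homology_class R L 3 z = \<zero>\<^bsub>ce_homology R L 3\<^esub>"
  using H.coset_eq_zero_iff boundaries_subset_cycles by (auto simp: homology_class_eq ce_homology_def)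

lemma cycles_hom:
  "f \<in> module_hom R E3.E P \<Longrightarrow> f \<in> module_hom R (E3.E\<lparr>carrier := ce_cycles R L 3\<rparr>) P"
  using submodule_carrier[OF cycles_submodule] by (auto simp: module_hom_def Pi_def)

section \<open>The Killing module and the Koszul map\<close>

abbreviation "sp \<equiv> sym_prod R L"

definition invariance_form where
  "invariance_form xs = sp (br (xs ! 0) (xs ! 1)) (xs ! 2) \<ominus>\<^bsub>S.S\<^esub> sp (xs ! 0) (br (xs ! 1) (xs ! 2))"

declare S.sym_prod_closed [simp, intro]

text \<open>This makes the defining map of the Killing module linear on the third tensor power, so
  that its image \<open>kill_null\<close> is a submodule without passing to a span.\<close>

lemma invariance_form_multilinear: "multilinear R L 3 S.S invariance_form"
  by (rule multilinear_3I[OF module_axioms])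
    (simp_all add: invariance_form_def module_hom_diff_pointwise MS.module_axioms
      S.sym_prod_hom_left S.sym_prod_hom_right
      module_hom_comp[OF bracket_hom_left S.sym_prod_hom_left] module_hom_comp[OF bracket_hom_right S.sym_prod_hom_left]
      module_hom_comp[OF bracket_hom_left S.sym_prod_hom_right] module_hom_comp[OF bracket_hom_right S.sym_prod_hom_right])

lemma kill_null_eq: "kill_null R L = tensor_lift R S.S invariance_form ` carrier E3.T"
  by (simp add: kill_null_def invariance_form_def[abs_def])

lemmas invariance_lift_hom = E3.tensor_lift_hom[OF MS.module_axioms invariance_form_multilinear]
lemmas invariance_lift_tensor = E3.tensor_lift_tensor[OF MS.module_axioms invariance_form_multilinear]

sublocale K: quotient_by R "sym_square R L" "kill_null R L"
  unfolding kill_null_eq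
  by (intro quotient_by.intro quotient_by_axioms.intro MS.module_axioms
      submodule_image[OF E3.tensor_module MS.module_axioms invariance_lift_hom])

abbreviation "KL \<equiv> kill R L"
abbreviation "B x y \<equiv> kill_class R L (sp x y)"

lemma kill_module: "module R KL"
  unfolding kill_def by (rule K.quotient_module_is_module)

sublocale MK: module R "kill R L" by (rule kill_module)

lemma kill_class_hom: "kill_class R L \<in> module_hom R S.S KL"
  using K.coset_hom unfolding kill_def kill_class_def[abs_def] .

lemma kill_carrier: "carrier KL = kill_class R L ` carrier S.S"
  unfolding kill_def kill_class_def using K.carrier_quotient by simp

lemma B_hom:
  assumes "y \<in> carrier L"
  shows "(\<lambda>x. B x y) \<in> module_hom R L KL" "(\<lambda>x. B y x) \<in> module_hom R L KL"
  using module_hom_comp[OF S.sym_prod_hom_left kill_class_hom] module_hom_comp[OF S.sym_prod_hom_right kill_class_hom]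
    assms by auto

lemma B_closed [simp, intro]: "x \<in> carrier L \<Longrightarrow> y \<in> carrier L \<Longrightarrow> B x y \<in> carrier KL"
  using B_hom(1) by (rule module_hom_closed)

lemma B_comm: "x \<in> carrier L \<Longrightarrow> y \<in> carrier L \<Longrightarrow> B x y = B y x"
  by (simp add: S.sym_prod_comm)

text \<open>The difference of the two symmetric products is the image of the pure tensor of x, y, z,
  hence an element of \<open>kill_null\<close>.\<close>

lemma B_invariant:
  assumes "x \<in> carrier L" "y \<in> carrier L" "z \<in> carrier L"
  shows "B (br x y) z = B x (br y z)"
proof -
  have xs: "[x, y, z] \<in> tuples L 3" using assms by (simp add: tuples_numeral)
  have "invariance_form [x, y, z] \<in> kill_null R L"
    unfolding kill_null_eq invariance_lift_tensor[OF xs, symmetric]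
    using E3.tensor_closed[OF xs] by (rule imageI)
  then show ?thesis
    using assms by (simp add: kill_class_def K.coset_eq_iff invariance_form_def)
qed

lemmas B_neg = module_hom_neg[OF module_axioms kill_module B_hom(1)]
  module_hom_neg[OF module_axioms kill_module B_hom(2)]
lemmas B_zero = module_hom_zero[OF module_axioms kill_module B_hom(1)]
  module_hom_zero[OF module_axioms kill_module B_hom(2)]
lemmas B_add = module_hom_add[OF B_hom(1)] module_hom_add[OF B_hom(2)]
lemmas B_smult = module_hom_smult[OF B_hom(1)] module_hom_smult[OF B_hom(2)]

definition koszul_form where
  "koszul_form xs = B (xs ! 0) (br (xs ! 1) (xs ! 2))"

lemma koszul_form_multilinear: "multilinear R L 3 KL koszul_form"
  by (rule multilinear_3I[OF module_axioms])
    (simp_all add: koszul_form_def B_hom module_hom_comp[OF bracket_hom_left B_hom(2)]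
       module_hom_comp[OF bracket_hom_right B_hom(2)])

text \<open>Invariance moves the bracket: B(x, [x, y]) = B([x, x], y) = 0. The other repetitions
  reduce to this by antisymmetry, or directly to [x, x] = 0.\<close>

lemma koszul_form_alternating: "alternating L 3 KL koszul_form"
proof (rule alternating_3I)
  fix x y assume [simp]: "x \<in> carrier L" "y \<in> carrier L"
  have zero: "B x (br x y) = \<zero>\<^bsub>KL\<^esub>"
    using B_invariant[of x x y] by (simp add: bracket_self B_zero)
  then show "koszul_form [x, x, y] = \<zero>\<^bsub>KL\<^esub>" by (simp add: koszul_form_def)
  show "koszul_form [x, y, x] = \<zero>\<^bsub>KL\<^esub>"
    using zero by (simp add: koszul_form_def bracket_swap[of x y] B_neg MK.neg_zero)
  show "koszul_form [y, x, x] = \<zero>\<^bsub>KL\<^esub>"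
    by (simp add: koszul_form_def bracket_self B_zero)
qed

lemma koszul_eq: "koszul R L = ext_lift R KL koszul_form"
  by (simp add: koszul_def koszul_form_def[abs_def])

lemma koszul_hom: "koszul R L \<in> module_hom R E3.E KL"
  using E3.ext_lift_hom[OF kill_module koszul_form_multilinear koszul_form_alternating]
  by (simp add: koszul_eq)

lemma koszul_wedge:
  assumes "x \<in> carrier L" "y \<in> carrier L" "z \<in> carrier L"
  shows "koszul R L (w3 x y z) = B x (br y z)"
  using E3.ext_lift_wedge[OF kill_module koszul_form_multilinear koszul_form_alternating, of "[x, y, z]"] assms
  by (simp add: koszul_eq koszul_form_def tuples_numeral)

text \<open>By symmetry of B each of the three pairings of two brackets occurs twice, so the value
  is -2 (p - q + r); the combination p - q + r vanishes by the Jacobi identity.\<close>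

lemma koszul_d4:
  assumes "v \<in> carrier E4.E"
  shows "koszul R L (d4 v) = \<zero>\<^bsub>KL\<^esub>"
proof (rule E4.ext_hom_eqI[OF kill_module module_hom_comp[OF d4_hom koszul_hom] zero_module_hom[OF kill_module] _ assms])
  fix xs assume "xs \<in> tuples L 4"
  then obtain x y z t where xs: "xs = [x, y, z, t]"
    and [simp]: "x \<in> carrier L" "y \<in> carrier L" "z \<in> carrier L" "t \<in> carrier L"
    by (rule tuples_4E)
  let ?p = "B (br x y) (br z t)" and ?q = "B (br x z) (br y t)" and ?r = "B (br x t) (br y z)"
  have comm: "B (br z t) (br x y) = ?p" "B (br y t) (br x z) = ?q" "B (br y z) (br x t) = ?r"
    by (simp_all add: B_comm)
  \<comment> \<open>Pairing x with the Jacobi sum of y, z, t and moving the outer bracket of each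
    term onto x by invariance yields p - q + r = 0.\<close>
  have "B x (br y (br z t) \<oplus>\<^bsub>L\<^esub> br z (br t y) \<oplus>\<^bsub>L\<^esub> br t (br y z)) = \<zero>\<^bsub>KL\<^esub>"
    by (simp add: jacobi B_zero)
  then have "?p \<oplus>\<^bsub>KL\<^esub> \<ominus>\<^bsub>KL\<^esub> ?q \<oplus>\<^bsub>KL\<^esub> ?r = \<zero>\<^bsub>KL\<^esub>"
    by (simp add: B_add B_invariant bracket_swap[of y t] B_neg
        module_hom_neg[OF module_axioms module_axioms bracket_hom_right])
  then have "?q = ?p \<oplus>\<^bsub>KL\<^esub> ?r"
    by (intro MK.eq_add_of_add_neg) auto
  then show "koszul R L (d4 (wedge R L xs)) = \<zero>\<^bsub>KL\<^esub>"
    by (simp add: xs d4_wedge module_hom_add[OF koszul_hom] module_hom_neg[OF ME3.module_axioms kill_module koszul_hom]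
        koszul_wedge comm MK.abelian_simps)
qed

lemma koszul_boundary: "z \<in> ce_boundaries R L 3 \<Longrightarrow> koszul R L z = \<zero>\<^bsub>KL\<^esub>"
  by (auto simp: mem_boundaries koszul_d4)

lemma reduced_koszul_class:
  "z \<in> ce_cycles R L 3 \<Longrightarrow> reduced_koszul R L (homology_class R L 3 z) = koszul R L z"
  unfolding reduced_koszul_def homology_class_eq
  using H.induced_coset[OF kill_module cycles_hom[OF koszul_hom] koszul_boundary] by simp

end

section \<open>Functoriality\<close>

lemma tuples_map: "f \<in> carrier M \<rightarrow> carrier N \<Longrightarrow> xs \<in> tuples M n \<Longrightarrow> map f xs \<in> tuples N n"
  by (auto simp: tuples_def)

lemma wedge_map_multilinear:
  assumes "module R M" "module R N" "f \<in> module_hom R M N"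
  shows "multilinear R M n (ext_power R N n) (\<lambda>xs. wedge R N (map f xs))"
proof -
  interpret N: ext_power_of R N n using assms(2) by (simp add: ext_power_of_def tensor_power_of_def)
  have f: "f \<in> carrier M \<rightarrow> carrier N" using module_hom_closed[OF assms(3)] by auto
  show ?thesis
    unfolding multilinear_def map_update
    using tuples_map[OF f] by (auto intro: N.wedge_closed
      module_hom_comp[OF assms(3) multilinear_slot[OF N.wedge_multilinear]])
qed

lemma wedge_map_alternating:
  assumes "module R M" "module R N" "f \<in> module_hom R M N"
  shows "alternating M n (ext_power R N n) (\<lambda>xs. wedge R N (map f xs))"
  unfolding alternating_def
proof (intro ballI allI impI)
  interpret N: ext_power_of R N n using assms(2) by (simp add: ext_power_of_def tensor_power_of_def)
  have f: "f \<in> carrier M \<rightarrow> carrier N" using module_hom_closed[OF assms(3)] by auto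
  fix xs i j assume xs: "xs \<in> tuples M n" and ij: "i < j \<and> j < n \<and> xs ! i = xs ! j"
  moreover have "length xs = n" using xs by (simp add: tuples_def)
  ultimately have "map f xs ! i = map f xs ! j" by simp
  then show "wedge R N (map f xs) = \<zero>\<^bsub>ext_power R N n\<^esub>"
    using N.wedge_alternating tuples_map[OF f xs] ij unfolding alternating_def by blast
qed

lemma ext_power_map_hom:
  assumes "module R M" "module R N" "f \<in> module_hom R M N"
  shows "ext_power_map R N n f \<in> module_hom R (ext_power R M n) (ext_power R N n)"
proof -
  interpret M: ext_power_of R M n using assms(1) by (simp add: ext_power_of_def tensor_power_of_def)
  interpret N: ext_power_of R N n using assms(2) by (simp add: ext_power_of_def tensor_power_of_def)
  show ?thesis
    unfolding ext_power_map_def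
    by (rule M.ext_lift_hom[OF N.ext_module wedge_map_multilinear[OF assms] wedge_map_alternating[OF assms]])
qed

lemma ext_power_map_wedge:
  assumes "module R M" "module R N" "f \<in> module_hom R M N" "xs \<in> tuples M n"
  shows "ext_power_map R N n f (wedge R M xs) = wedge R N (map f xs)"
proof -
  interpret M: ext_power_of R M n using assms(1) by (simp add: ext_power_of_def tensor_power_of_def)
  interpret N: ext_power_of R N n using assms(2) by (simp add: ext_power_of_def tensor_power_of_def)
  show ?thesis
    unfolding ext_power_map_def
    by (rule M.ext_lift_wedge[OF N.ext_module wedge_map_multilinear[OF assms(1-3)]
          wedge_map_alternating[OF assms(1-3)] assms(4)])
qed

context
  fixes R :: "('a, 'r) ring_scheme" and M :: "('a, 'b, 'm) module_scheme"
    and N :: "('a, 'c, 'n) module_scheme" and f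
  assumes M: "module R M" and N: "module R N" and f: "f \<in> module_hom R M N"
begin

interpretation M: sym_square_of R M using M by (simp add: sym_square_of_def tensor_power_of_def)
interpretation N: sym_square_of R N using N by (simp add: sym_square_of_def tensor_power_of_def)

lemma sym_map_multilinear:
  "multilinear R M 2 (sym_square R N) (\<lambda>xs. sym_prod R N (f (xs ! 0)) (f (xs ! 1)))"
  by (rule multilinear_2I[OF M])
    (use module_hom_closed[OF f] in \<open>auto intro: module_hom_comp[OF f N.sym_prod_hom_left]
       module_hom_comp[OF f N.sym_prod_hom_right]\<close>)

lemma sym_map_comm:
  "x \<in> carrier M \<Longrightarrow> y \<in> carrier M \<Longrightarrow>
    sym_prod R N (f ([x, y] ! 0)) (f ([x, y] ! 1)) = sym_prod R N (f ([y, x] ! 0)) (f ([y, x] ! 1))"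
  using module_hom_closed[OF f] by (simp add: N.sym_prod_comm)

lemma sym_square_map_hom: "sym_square_map R N f \<in> module_hom R (sym_square R M) (sym_square R N)"
  unfolding sym_square_map_def
  by (rule M.sym_lift_hom[OF N.sym_module sym_map_multilinear sym_map_comm])

lemma sym_square_map_prod:
  assumes "x \<in> carrier M" "y \<in> carrier M"
  shows "sym_square_map R N f (sym_prod R M x y) = sym_prod R N (f x) (f y)"
  unfolding sym_square_map_def
  using M.sym_lift_prod[OF N.sym_module sym_map_multilinear sym_map_comm assms] by simp

end

section \<open>Maps induced by a homomorphism of Lie algebras and their compatibility with
  boundaries and Koszul maps\<close>

locale lie_hom = src: lie_algebra R L + tgt: lie_algebra R L'
  for R :: "('a, 'r) ring_scheme" and L :: "('a, 'b, 'm) lie_scheme"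
    and L' :: "('a, 'c, 'n) lie_scheme" +
  fixes f :: "'b \<Rightarrow> 'c"
  assumes hom: "f \<in> module_hom R L L'"
    and bracket: "\<And>x y. x \<in> carrier L \<Longrightarrow> y \<in> carrier L \<Longrightarrow> f (bracket L x y) = bracket L' (f x) (f y)"
begin

lemma closed [simp, intro]: "x \<in> carrier L \<Longrightarrow> f x \<in> carrier L'"
  using hom by (rule module_hom_closed)

abbreviation "\<Lambda> n \<equiv> ext_power_map R L' n f"
abbreviation "\<sigma> \<equiv> sym_square_map R L' f"

lemmas ext_hom = ext_power_map_hom[OF src.module_axioms tgt.module_axioms hom]
lemmas ext_wedge = ext_power_map_wedge[OF src.module_axioms tgt.module_axioms hom]
lemmas sym_hom = sym_square_map_hom[OF src.module_axioms tgt.module_axioms hom]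
lemmas sym_prod = sym_square_map_prod[OF src.module_axioms tgt.module_axioms hom]

lemma ext_wedge_2:
  "x \<in> carrier L \<Longrightarrow> y \<in> carrier L \<Longrightarrow> \<Lambda> 2 (src.w2 x y) = tgt.w2 (f x) (f y)"
  using ext_wedge[of "[x, y]" 2] by (simp add: tuples_numeral)

lemma ext_wedge_3:
  "x \<in> carrier L \<Longrightarrow> y \<in> carrier L \<Longrightarrow> z \<in> carrier L \<Longrightarrow> \<Lambda> 3 (src.w3 x y z) = tgt.w3 (f x) (f y) (f z)"
  using ext_wedge[of "[x, y, z]" 3] by (simp add: tuples_numeral)

lemma ext_wedge_4:
  "x \<in> carrier L \<Longrightarrow> y \<in> carrier L \<Longrightarrow> z \<in> carrier L \<Longrightarrow> t \<in> carrier L \<Longrightarrow>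
    \<Lambda> 4 (src.w4 x y z t) = tgt.w4 (f x) (f y) (f z) (f t)"
  using ext_wedge[of "[x, y, z, t]" 4] by (simp add: tuples_numeral)

lemma d3_natural:
  assumes "z \<in> carrier src.E3.E"
  shows "tgt.d3 (\<Lambda> 3 z) = \<Lambda> 2 (src.d3 z)"
proof (rule src.E3.ext_hom_eqI[OF tgt.ME2.module_axioms module_hom_comp[OF ext_hom tgt.d3_hom]
      module_hom_comp[OF src.d3_hom ext_hom] _ assms])
  fix xs assume "xs \<in> tuples L 3"
  then obtain x y z where xs: "xs = [x, y, z]"
    and [simp]: "x \<in> carrier L" "y \<in> carrier L" "z \<in> carrier L"
    by (rule tuples_3E)
  show "tgt.d3 (\<Lambda> 3 (wedge R L xs)) = \<Lambda> 2 (src.d3 (wedge R L xs))"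
    by (simp add: xs ext_wedge_3 src.d3_wedge tgt.d3_wedge module_hom_add[OF ext_hom]
        module_hom_neg[OF src.ME2.module_axioms tgt.ME2.module_axioms ext_hom] ext_wedge_2 bracket)
qed

lemma d4_natural:
  assumes "z \<in> carrier src.E4.E"
  shows "tgt.d4 (\<Lambda> 4 z) = \<Lambda> 3 (src.d4 z)"
proof (rule src.E4.ext_hom_eqI[OF tgt.ME3.module_axioms module_hom_comp[OF ext_hom tgt.d4_hom]
      module_hom_comp[OF src.d4_hom ext_hom] _ assms])
  fix xs assume "xs \<in> tuples L 4"
  then obtain x y z t where xs: "xs = [x, y, z, t]"
    and [simp]: "x \<in> carrier L" "y \<in> carrier L" "z \<in> carrier L" "t \<in> carrier L"
    by (rule tuples_4E)
  show "tgt.d4 (\<Lambda> 4 (wedge R L xs)) = \<Lambda> 3 (src.d4 (wedge R L xs))"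
    by (simp add: xs ext_wedge_4 src.d4_wedge tgt.d4_wedge module_hom_add[OF ext_hom]
        module_hom_neg[OF src.ME3.module_axioms tgt.ME3.module_axioms ext_hom] ext_wedge_3 bracket)
qed

lemma cycles_map: "z \<in> ce_cycles R L 3 \<Longrightarrow> \<Lambda> 3 z \<in> ce_cycles R L' 3"
  using module_hom_closed[OF ext_hom] d3_natural module_hom_zero[OF src.ME2.module_axioms tgt.ME2.module_axioms ext_hom]
  by (simp add: src.mem_cycles tgt.mem_cycles)

lemma boundaries_map:
  assumes "z \<in> ce_boundaries R L 3"
  shows "\<Lambda> 3 z \<in> ce_boundaries R L' 3"
proof -
  obtain v where "v \<in> carrier src.E4.E" "z = src.d4 v" using assms by (auto simp: src.mem_boundaries)
  then have "\<Lambda> 3 z = tgt.d4 (\<Lambda> 4 v)" "\<Lambda> 4 v \<in> carrier tgt.E4.E"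
    using d4_natural module_hom_closed[OF ext_hom] by auto
  then show ?thesis by (auto simp: tgt.mem_boundaries)
qed

lemma class_map_hom:
  "(\<lambda>z. homology_class R L' 3 (\<Lambda> 3 z)) \<in>
    module_hom R (src.E3.E\<lparr>carrier := ce_cycles R L 3\<rparr>) (ce_homology R L' 3)"
proof (rule module_hom_comp[OF _ tgt.homology_class_hom])
  \<comment> \<open>The map has to be read between the records restricted to cycles, so its closure
    condition is that cycles go to cycles.\<close>
  show "\<Lambda> 3 \<in> module_hom R (src.E3.E\<lparr>carrier := ce_cycles R L 3\<rparr>) (tgt.E3.E\<lparr>carrier := ce_cycles R L' 3\<rparr>)"
    by (rule module_homI)
      (auto simp: cycles_map src.mem_cycles module_hom_add[OF ext_hom] module_hom_smult[OF ext_hom])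
qed

lemma class_map_boundary:
  "z \<in> ce_boundaries R L 3 \<Longrightarrow> homology_class R L' 3 (\<Lambda> 3 z) = \<zero>\<^bsub>ce_homology R L' 3\<^esub>"
  by (intro tgt.homology_class_zero boundaries_map)

lemma homology_map_hom: "ce_homology_map R L' 3 f \<in> module_hom R (ce_homology R L 3) (ce_homology R L' 3)"
  using src.H.induced_hom[OF tgt.homology_module class_map_hom class_map_boundary]
  unfolding ce_homology_map_def ce_homology_def .

lemma homology_map_class:
  "z \<in> ce_cycles R L 3 \<Longrightarrow>
    ce_homology_map R L' 3 f (homology_class R L 3 z) = homology_class R L' 3 (\<Lambda> 3 z)"
  using src.H.induced_coset[OF tgt.homology_module class_map_hom class_map_boundary]
  unfolding ce_homology_map_def src.homology_class_eq by simp

text \<open>An element of \<open>kill_null\<close> is the lift of some tensor, so by linearity pure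
  tensors suffice; there \<open>f\<close> turns the relation for x, y, z into the relation for their
  images.\<close>

lemma kill_map_null:
  assumes "s \<in> kill_null R L"
  shows "kill_class R L' (\<sigma> s) = \<zero>\<^bsub>kill R L'\<^esub>"
proof -
  obtain p where p: "p \<in> carrier src.E3.T" "s = tensor_lift R src.S.S src.invariance_form p"
    using assms by (auto simp: src.kill_null_eq)
  note h = module_hom_comp[OF src.invariance_lift_hom module_hom_comp[OF sym_hom tgt.kill_class_hom]]
  have "kill_class R L' (\<sigma> (tensor_lift R src.S.S src.invariance_form p)) = \<zero>\<^bsub>kill R L'\<^esub>"
  proof (rule src.E3.tensor_hom_eqI[OF tgt.kill_module h zero_module_hom[OF tgt.kill_module] _ p(1)])
    fix xs assume xs: "xs \<in> tuples L 3"
    then obtain x y z where xs': "xs = [x, y, z]"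
      and [simp]: "x \<in> carrier L" "y \<in> carrier L" "z \<in> carrier L"
      by (rule tuples_3E)
    show "kill_class R L' (\<sigma> (tensor_lift R src.S.S src.invariance_form (tensor R L xs))) = \<zero>\<^bsub>kill R L'\<^esub>"
      unfolding src.invariance_lift_tensor[OF xs]
      by (simp add: xs' src.invariance_form_def sym_prod bracket
          module_hom_diff[OF src.MS.module_axioms tgt.MS.module_axioms sym_hom]
          module_hom_diff[OF tgt.MS.module_axioms tgt.kill_module tgt.kill_class_hom]
          tgt.B_invariant tgt.MK.minus_eq tgt.MK.r_neg)
  qed
  then show ?thesis by (simp add: p)
qed

lemma kill_map_hom: "kill_map R L' f \<in> module_hom R (kill R L) (kill R L')"
  using src.K.induced_hom[OF tgt.kill_module module_hom_comp[OF sym_hom tgt.kill_class_hom] kill_map_null]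
  unfolding kill_map_def kill_def .

lemma kill_map_class:
  "s \<in> carrier src.S.S \<Longrightarrow> kill_map R L' f (kill_class R L s) = kill_class R L' (\<sigma> s)"
  using src.K.induced_coset[OF tgt.kill_module module_hom_comp[OF sym_hom tgt.kill_class_hom] kill_map_null]
  unfolding kill_map_def by (simp add: kill_class_def)

lemma koszul_natural:
  assumes "z \<in> carrier src.E3.E"
  shows "koszul R L' (\<Lambda> 3 z) = kill_map R L' f (koszul R L z)"
proof (rule src.E3.ext_hom_eqI[OF tgt.kill_module module_hom_comp[OF ext_hom tgt.koszul_hom]
      module_hom_comp[OF src.koszul_hom kill_map_hom] _ assms])
  fix xs assume "xs \<in> tuples L 3"
  then obtain x y z where xs: "xs = [x, y, z]"
    and [simp]: "x \<in> carrier L" "y \<in> carrier L" "z \<in> carrier L"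
    by (rule tuples_3E)
  show "koszul R L' (\<Lambda> 3 (wedge R L xs)) = kill_map R L' f (koszul R L (wedge R L xs))"
    by (simp add: xs ext_wedge_3 src.koszul_wedge tgt.koszul_wedge kill_map_class sym_prod bracket)
qed

text \<open>Applied to the inclusion of the degree 0 part, this square is the comparison of the two
  reduced Koszul maps. It follows from \<open>koszul_natural\<close> on a representing
  cycle.\<close>

lemma reduced_koszul_natural:
  assumes "c \<in> carrier (ce_homology R L 3)"
  shows "reduced_koszul R L' (ce_homology_map R L' 3 f c) = kill_map R L' f (reduced_koszul R L c)"
proof -
  obtain z where "z \<in> ce_cycles R L 3" "c = homology_class R L 3 z"
    using assms by (auto simp: src.homology_carrier)
  then show ?thesis
    by (simp add: homology_map_class cycles_map src.reduced_koszul_class tgt.reduced_koszul_class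
        koszul_natural src.mem_cycles)
qed

end

section \<open>Gradings\<close>

context graded_lie_algebra
begin

lemma degree_submodule: "submodule (G n) R L"
  using grading by (simp add: direct_sum_decomposition_def)

lemma degree_carrier: "x \<in> G n \<Longrightarrow> x \<in> carrier L"
  using submodule_carrier[OF degree_submodule] .

definition is_decomposition where
  "is_decomposition x c \<longleftrightarrow> (\<forall>i. c i \<in> G i) \<and> finite {i. c i \<noteq> \<zero>\<^bsub>L\<^esub>} \<and>
    x = (\<Oplus>\<^bsub>L\<^esub>i\<in>{i. c i \<noteq> \<zero>\<^bsub>L\<^esub>}. c i)"

definition component where
  "component x = (THE c. is_decomposition x c)"

abbreviation "degrees x \<equiv> {i. component x i \<noteq> \<zero>\<^bsub>L\<^esub>}"

lemma decomposition_ex1: "x \<in> carrier L \<Longrightarrow> \<exists>!c. is_decomposition x c"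
  using grading by (simp add: direct_sum_decomposition_def is_decomposition_def)

lemma component_decomposition: "x \<in> carrier L \<Longrightarrow> is_decomposition x (component x)"
  unfolding component_def by (rule theI'[OF decomposition_ex1])

lemma component_degree: "x \<in> carrier L \<Longrightarrow> component x i \<in> G i"
  using component_decomposition by (simp add: is_decomposition_def)

lemma component_closed [simp, intro]: "x \<in> carrier L \<Longrightarrow> component x i \<in> carrier L"
  using component_degree degree_carrier by blast

lemma finite_degrees: "x \<in> carrier L \<Longrightarrow> finite (degrees x)"
  using component_decomposition by (simp add: is_decomposition_def)

lemma finsum_mono_neutral:
  assumes "finite T" "S \<subseteq> T" "\<And>i. i \<in> T \<Longrightarrow> g i \<in> carrier L" "\<And>i. i \<in> T - S \<Longrightarrow> g i = \<zero>\<^bsub>L\<^esub>"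
  shows "(\<Oplus>\<^bsub>L\<^esub>i\<in>S. g i) = (\<Oplus>\<^bsub>L\<^esub>i\<in>T. g i)"
  by (rule M.add.finprod_mono_neutral_cong_left) (use assms in auto)

lemma sum_components:
  assumes "x \<in> carrier L" "finite T" "degrees x \<subseteq> T"
  shows "(\<Oplus>\<^bsub>L\<^esub>i\<in>T. component x i) = x"
proof -
  have "x = (\<Oplus>\<^bsub>L\<^esub>i\<in>degrees x. component x i)"
    using component_decomposition[OF assms(1)] by (simp add: is_decomposition_def)
  also have "\<dots> = (\<Oplus>\<^bsub>L\<^esub>i\<in>T. component x i)"
    using assms by (intro finsum_mono_neutral) auto
  finally show ?thesis by simp
qed

text \<open>Enlarging the index set only adds zero terms, and uniqueness of the decomposition does
  the rest. The freedom in \<open>T\<close> is what gives linearity of components, since the set of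
  nonzero degrees may shrink under sums and multiples.\<close>

lemma component_eqI:
  assumes c: "\<And>i. c i \<in> G i" and T: "finite T" "{i. c i \<noteq> \<zero>\<^bsub>L\<^esub>} \<subseteq> T"
    and x: "x = (\<Oplus>\<^bsub>L\<^esub>i\<in>T. c i)"
  shows "component x = c"
proof -
  have cc: "c i \<in> carrier L" for i using c degree_carrier by blast
  have "(\<Oplus>\<^bsub>L\<^esub>i\<in>{i. c i \<noteq> \<zero>\<^bsub>L\<^esub>}. c i) = (\<Oplus>\<^bsub>L\<^esub>i\<in>T. c i)"
    using T cc by (intro finsum_mono_neutral) auto
  then have "is_decomposition x c"
    using c x finite_subset[OF T(2,1)] by (simp add: is_decomposition_def)
  moreover have "x \<in> carrier L" unfolding x using cc by (intro M.finsum_closed) auto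
  ultimately show ?thesis using decomposition_ex1 component_decomposition by blast
qed

lemma component_add:
  assumes x: "x \<in> carrier L" and y: "y \<in> carrier L"
  shows "component (x \<oplus>\<^bsub>L\<^esub> y) = (\<lambda>i. component x i \<oplus>\<^bsub>L\<^esub> component y i)"
proof (rule component_eqI[where T = "degrees x \<union> degrees y"])
  show "x \<oplus>\<^bsub>L\<^esub> y = (\<Oplus>\<^bsub>L\<^esub>i\<in>degrees x \<union> degrees y. component x i \<oplus>\<^bsub>L\<^esub> component y i)"
    using x y by (simp add: M.finsum_addf sum_components finite_degrees)
qed (use x y in \<open>auto intro: submodule_add[OF degree_submodule] component_degree finite_degrees\<close>)

lemma component_smult:
  assumes x: "x \<in> carrier L" and a: "a \<in> carrier R"
  shows "component (a \<odot>\<^bsub>L\<^esub> x) = (\<lambda>i. a \<odot>\<^bsub>L\<^esub> component x i)"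
proof (rule component_eqI[where T = "degrees x"])
  show "a \<odot>\<^bsub>L\<^esub> x = (\<Oplus>\<^bsub>L\<^esub>i\<in>degrees x. a \<odot>\<^bsub>L\<^esub> component x i)"
    using x a by (simp add: finsum_smult_ldistr[symmetric] sum_components finite_degrees)
qed (use x a in \<open>auto intro: submodule.smult_closed[OF degree_submodule] component_degree finite_degrees\<close>)

lemma component_homogeneous:
  assumes "x \<in> G n"
  shows "component x = (\<lambda>i. if i = n then x else \<zero>\<^bsub>L\<^esub>)"
  by (rule component_eqI[where T = "{n}"])
    (use assms degree_carrier[OF assms] submodule_zero[OF degree_submodule] in auto)

text \<open>The operator acting on degree \<open>i\<close> as the scalar \<open>c i\<close>. Two
  choices matter: the degree itself, which gives the map D, and the indicator of 0, which gives the
  projection onto \<open>G 0\<close>.\<close>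

definition scale where
  "scale c x = (\<Oplus>\<^bsub>L\<^esub>i\<in>degrees x. c i \<odot>\<^bsub>L\<^esub> component x i)"

context
  fixes c :: "nat \<Rightarrow> 'a" assumes c: "\<And>i. c i \<in> carrier R"
begin

lemma scale_superset:
  assumes "x \<in> carrier L" "finite T" "degrees x \<subseteq> T"
  shows "scale c x = (\<Oplus>\<^bsub>L\<^esub>i\<in>T. c i \<odot>\<^bsub>L\<^esub> component x i)"
  unfolding scale_def using assms c by (intro finsum_mono_neutral) auto

lemma scale_hom: "scale c \<in> module_hom R L L"
proof (rule module_homI)
  fix x assume x: "x \<in> carrier L"
  then show "scale c x \<in> carrier L" unfolding scale_def using c by (intro M.finsum_closed) auto
  {
    fix y assume y: "y \<in> carrier L"
    let ?T = "degrees x \<union> degrees y"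
    have T: "finite ?T" using x y by (simp add: finite_degrees)
    have "scale c (x \<oplus>\<^bsub>L\<^esub> y) = (\<Oplus>\<^bsub>L\<^esub>i\<in>?T. c i \<odot>\<^bsub>L\<^esub> (component x i \<oplus>\<^bsub>L\<^esub> component y i))"
      using x y T by (subst scale_superset[of _ ?T]) (auto simp: component_add)
    also have "\<dots> = (\<Oplus>\<^bsub>L\<^esub>i\<in>?T. c i \<odot>\<^bsub>L\<^esub> component x i \<oplus>\<^bsub>L\<^esub> c i \<odot>\<^bsub>L\<^esub> component y i)"
      using x y c by (simp add: smult_r_distr)
    also have "\<dots> = scale c x \<oplus>\<^bsub>L\<^esub> scale c y"
      using x y c T by (simp add: M.finsum_addf scale_superset[of _ ?T] Pi_def)
    finally show "scale c (x \<oplus>\<^bsub>L\<^esub> y) = scale c x \<oplus>\<^bsub>L\<^esub> scale c y" .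
  }
  fix a assume a: "a \<in> carrier R"
  have "scale c (a \<odot>\<^bsub>L\<^esub> x) = (\<Oplus>\<^bsub>L\<^esub>i\<in>degrees x. c i \<odot>\<^bsub>L\<^esub> (a \<odot>\<^bsub>L\<^esub> component x i))"
    using x a by (subst scale_superset[of _ "degrees x"]) (auto simp: component_smult finite_degrees)
  also have "\<dots> = (\<Oplus>\<^bsub>L\<^esub>i\<in>degrees x. a \<odot>\<^bsub>L\<^esub> (c i \<odot>\<^bsub>L\<^esub> component x i))"
    using x a c by (simp add: smult_assoc1[symmetric] R.m_comm)
  also have "\<dots> = a \<odot>\<^bsub>L\<^esub> scale c x"
    unfolding scale_def using x a c by (simp add: finsum_smult_ldistr finite_degrees)
  finally show "scale c (a \<odot>\<^bsub>L\<^esub> x) = a \<odot>\<^bsub>L\<^esub> scale c x" .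
qed

lemma scale_homogeneous:
  assumes "x \<in> G n"
  shows "scale c x = c n \<odot>\<^bsub>L\<^esub> x"
proof -
  have "degrees x \<subseteq> {n}" using assms by (auto simp: component_homogeneous)
  then show ?thesis
    using scale_superset[of x "{n}"] assms degree_carrier[OF assms] c
    by (simp add: component_homogeneous)
qed

end

text \<open>Every element is the finite sum of its components, each of which lies in
  \<open>H\<close>. Consequently linear maps on \<open>L\<close> can be compared on homogeneous
  elements.\<close>

lemma graded_submodule_full:
  assumes "submodule H R L" "\<And>n. G n \<subseteq> H" "x \<in> carrier L"
  shows "x \<in> H"
proof -
  have "(\<Oplus>\<^bsub>L\<^esub>i\<in>degrees x. component x i) \<in> H"
    using assms component_degree finite_degrees
    by (intro submodule_finsum[OF module_axioms assms(1)]) auto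
  then show ?thesis using sum_components assms(3) finite_degrees by auto
qed

lemma graded_hom_eqI:
  assumes "module R N" "f \<in> module_hom R L N" "g \<in> module_hom R L N"
    and "\<And>n x. x \<in> G n \<Longrightarrow> f x = g x" "x \<in> carrier L"
  shows "f x = g x"
proof -
  have "x \<in> {x \<in> carrier L. f x = g x}"
    by (rule graded_submodule_full[OF submodule_equalizer[OF module_axioms assms(1-3)] _ assms(5)])
      (use assms(4) degree_carrier in blast)
  then show ?thesis by simp
qed

section \<open>Vanishing in nonzero degrees\<close>

lemma wedge_degree_subset:
  "{wedge R L xs | xs ds. length xs = k \<and> list_all2 (\<lambda>x d. x \<in> G d) xs ds \<and> sum_list ds = n}
    \<subseteq> wedge R L ` tuples L k"
proof safe
  fix xs ds assume "k = length xs" "list_all2 (\<lambda>x d. x \<in> G d) xs ds"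
  then have "set xs \<subseteq> carrier L"
    by (induction xs arbitrary: ds k) (auto simp: list_all2_Cons1 intro: degree_carrier)
  then show "wedge R L xs \<in> wedge R L ` tuples L (length xs)"
    by (intro imageI) (simp add: tuples_def)
qed

lemma wedge_degree_carrier:
  "{wedge R L xs | xs ds. length xs = 3 \<and> list_all2 (\<lambda>x d. x \<in> G d) xs ds \<and> sum_list ds = n}
    \<subseteq> carrier E3.E"
proof (rule order_trans[OF wedge_degree_subset])
  show "wedge R L ` tuples L 3 \<subseteq> carrier E3.E" by (rule image_subsetI) (rule E3.wedge_closed)
qed

lemma ext_degree_submodule: "submodule (ext_power_degree R L G 3 n) R E3.E"
  unfolding ext_power_degree_def
  by (intro module_span_submodule ME3.module_axioms wedge_degree_carrier)

text \<open>The degree part is by definition the span of wedges of homogeneous entries, so agreement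
  on these generators suffices; the lists of entries and degrees are unpacked into three variables
  each.\<close>

lemma ext_degree_hom_eqI:
  assumes "module R P" "f \<in> module_hom R E3.E P" "g \<in> module_hom R E3.E P"
    and eq: "\<And>x y z i j k. x \<in> G i \<Longrightarrow> y \<in> G j \<Longrightarrow> z \<in> G k \<Longrightarrow> i + j + k = n \<Longrightarrow>
      f (w3 x y z) = g (w3 x y z)"
    and "v \<in> ext_power_degree R L G 3 n"
  shows "f v = g v"
proof (rule module_hom_eq_on_span[OF ME3.module_axioms assms(1-3) _ _ assms(5)[unfolded ext_power_degree_def]])
  show "{wedge R L xs | xs ds. length xs = 3 \<and> list_all2 (\<lambda>x d. x \<in> G d) xs ds \<and> sum_list ds = n}
    \<subseteq> carrier E3.E"
    by (rule wedge_degree_carrier)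
  fix w assume "w \<in> {wedge R L xs | xs ds. length xs = 3 \<and> list_all2 (\<lambda>x d. x \<in> G d) xs ds \<and> sum_list ds = n}"
  then obtain x y z i j k where "w = w3 x y z" "x \<in> G i" "y \<in> G j" "z \<in> G k" "i + j + k = n"
    by (auto simp: numeral_3_eq_3 length_Suc_conv list_all2_Cons1 add.assoc)
  then show "f w = g w" using eq by auto
qed

context
  fixes \<nu> :: "nat \<Rightarrow> 'a"
  assumes \<nu>: "\<And>n. \<nu> n \<in> carrier R" and \<nu>_add: "\<And>m n. \<nu> (m + n) = \<nu> m \<oplus>\<^bsub>R\<^esub> \<nu> n"
begin

text \<open>Here \<open>\<nu> n\<close> represents the integer n as a scalar of \<open>R\<close>,
  through additivity alone, and \<open>scale \<nu>\<close> is the map D. Inverting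
  \<open>\<nu> n\<close> is postponed to \<open>koszul_cycle_zero\<close>.\<close>

definition \<Phi>_form where
  "\<Phi>_form xs = B (scale \<nu> (xs ! 0)) (xs ! 1) \<ominus>\<^bsub>KL\<^esub> B (xs ! 0) (scale \<nu> (xs ! 1))"

definition \<Phi> where "\<Phi> = ext_lift R KL \<Phi>_form"

lemma scale_\<nu>_closed [simp, intro]: "x \<in> carrier L \<Longrightarrow> scale \<nu> x \<in> carrier L"
  using scale_hom[OF \<nu>] by (rule module_hom_closed)

lemma \<Phi>_form_multilinear: "multilinear R L 2 KL \<Phi>_form"
  by (rule multilinear_2I[OF module_axioms])
    (simp_all add: \<Phi>_form_def module_hom_diff_pointwise kill_module B_hom
      module_hom_comp[OF scale_hom[OF \<nu>] B_hom(1)] module_hom_comp[OF scale_hom[OF \<nu>] B_hom(2)])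

text \<open>On a repeated entry the two terms are B(D x, x) and B(x, D x), which agree by
  symmetry.\<close>

lemma \<Phi>_form_alternating: "alternating L 2 KL \<Phi>_form"
  by (rule alternating_2I)
    (simp add: \<Phi>_form_def MK.minus_eq MK.r_neg B_comm[of "scale \<nu> x" x for x])

lemma \<Phi>_hom: "\<Phi> \<in> module_hom R E2.E KL"
  unfolding \<Phi>_def by (rule E2.ext_lift_hom[OF kill_module \<Phi>_form_multilinear \<Phi>_form_alternating])

lemma \<Phi>_wedge:
  assumes "x \<in> G i" "y \<in> G j"
  shows "\<Phi> (w2 x y) = \<nu> i \<odot>\<^bsub>KL\<^esub> B x y \<ominus>\<^bsub>KL\<^esub> \<nu> j \<odot>\<^bsub>KL\<^esub> B x y"
  using E2.ext_lift_wedge[OF kill_module \<Phi>_form_multilinear \<Phi>_form_alternating, of "[x, y]"]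
    assms degree_carrier[OF assms(1)] degree_carrier[OF assms(2)] \<nu>
  by (simp add: \<Phi>_def \<Phi>_form_def tuples_numeral scale_homogeneous B_smult)

lemma \<Phi>_d3:
  assumes "v \<in> ext_power_degree R L G 3 n"
  shows "\<Phi> (d3 v) = \<ominus>\<^bsub>KL\<^esub> (\<nu> n \<odot>\<^bsub>KL\<^esub> koszul R L v)"
proof (rule ext_degree_hom_eqI[OF kill_module module_hom_comp[OF d3_hom \<Phi>_hom]
      module_hom_neg_pointwise[OF kill_module module_hom_smult_pointwise[OF kill_module koszul_hom \<nu>]] _ assms])
  fix x y z i j k assume xyz: "x \<in> G i" "y \<in> G j" "z \<in> G k" and n: "i + j + k = n"
  note [simp] = degree_carrier[OF xyz(1)] degree_carrier[OF xyz(2)] degree_carrier[OF xyz(3)] \<nu>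
  let ?t = "B x (br y z)"
  \<comment> \<open>Invariance and symmetry express all three boundary terms through the single
    element \<open>?t\<close>. The sign of the middle one compensates the sign pattern of
    \<open>d3_wedge\<close>, so that all three weights enter with a minus sign.\<close>
  have t: "B (br x y) z = ?t" "B (br x z) y = \<ominus>\<^bsub>KL\<^esub> ?t" "B (br y z) x = ?t"
    using bracket_swap[of y z] B_comm[of "br y z" x]
    by (simp_all add: B_invariant[of x y z] B_invariant[of x z y] B_neg)
  show "\<Phi> (d3 (w3 x y z)) = \<ominus>\<^bsub>KL\<^esub> (\<nu> n \<odot>\<^bsub>KL\<^esub> koszul R L (w3 x y z))"
    using \<Phi>_wedge[OF bracket_graded[OF xyz(1,2)] xyz(3)] \<Phi>_wedge[OF bracket_graded[OF xyz(1,3)] xyz(2)]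
      \<Phi>_wedge[OF bracket_graded[OF xyz(2,3)] xyz(1)]
    by (simp add: d3_wedge koszul_wedge module_hom_add[OF \<Phi>_hom]
        module_hom_neg[OF ME2.module_axioms kill_module \<Phi>_hom] t n[symmetric] \<nu>_add
        MK.smult_l_distr MK.smult_r_minus MK.abelian_simps)
qed

lemma koszul_cycle_zero:
  assumes u: "u \<in> carrier R" "u \<otimes>\<^bsub>R\<^esub> \<nu> n = \<one>\<^bsub>R\<^esub>"
    and z: "z \<in> ce_cycles R L 3" "z \<in> ext_power_degree R L G 3 n"
  shows "koszul R L z = \<zero>\<^bsub>KL\<^esub>"
proof -
  have k: "koszul R L z \<in> carrier KL"
    using z(1) module_hom_closed[OF koszul_hom] by (simp add: mem_cycles)
  have "\<ominus>\<^bsub>KL\<^esub> (\<nu> n \<odot>\<^bsub>KL\<^esub> koszul R L z) = \<zero>\<^bsub>KL\<^esub>"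
    using \<Phi>_d3[OF z(2)] z(1) module_hom_zero[OF ME2.module_axioms kill_module \<Phi>_hom]
    by (simp add: mem_cycles)
  then have "\<nu> n \<odot>\<^bsub>KL\<^esub> koszul R L z = \<zero>\<^bsub>KL\<^esub>"
    using k \<nu> MK.minus_minus[of "\<nu> n \<odot>\<^bsub>KL\<^esub> koszul R L z"] by (simp add: MK.neg_zero)
  then have "(u \<otimes>\<^bsub>R\<^esub> \<nu> n) \<odot>\<^bsub>KL\<^esub> koszul R L z = \<zero>\<^bsub>KL\<^esub>"
    using k u(1) \<nu> by (simp add: MK.smult_assoc1)
  then show ?thesis using k u(2) by simp
qed

lemma reduced_koszul_vanishes:
  assumes "u \<in> carrier R" "u \<otimes>\<^bsub>R\<^esub> \<nu> n = \<one>\<^bsub>R\<^esub>" "c \<in> ce_homology_degree R L G 3 n"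
  shows "reduced_koszul R L c = \<zero>\<^bsub>KL\<^esub>"
  using assms koszul_cycle_zero by (auto simp: ce_homology_degree_def reduced_koszul_class)

end

section \<open>Degree zero\<close>

abbreviation "L0 \<equiv> L\<lparr>carrier := G 0\<rparr>"

definition "proj = scale (\<lambda>i. if i = 0 then \<one>\<^bsub>R\<^esub> else \<zero>\<^bsub>R\<^esub>)"

lemma proj_hom: "proj \<in> module_hom R L L"
  unfolding proj_def by (rule scale_hom) simp

lemma proj_closed: "x \<in> carrier L \<Longrightarrow> proj x \<in> carrier L"
  using proj_hom by (rule module_hom_closed)

lemma proj_homogeneous: "x \<in> G n \<Longrightarrow> proj x = (if n = 0 then x else \<zero>\<^bsub>L\<^esub>)"
  unfolding proj_def using degree_carrier by (subst scale_homogeneous) auto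

text \<open>A homogeneous element is either fixed, in degree 0, or sent to zero; both values lie in
  \<open>G 0\<close>, and this extends to sums.\<close>

lemma proj_degree_0: "x \<in> carrier L \<Longrightarrow> proj x \<in> G 0"
proof -
  assume "x \<in> carrier L"
  have "x \<in> {x \<in> carrier L. proj x \<in> G 0}"
    by (rule graded_submodule_full[OF submodule_vimage[OF module_axioms module_axioms proj_hom degree_submodule] _ \<open>x \<in> carrier L\<close>])
      (auto simp: proj_homogeneous degree_carrier submodule_zero[OF degree_submodule])
  then show ?thesis by simp
qed

text \<open>By bilinearity both entries may be taken homogeneous, of degrees m and n. As m + n = 0
  only for m = n = 0, either nothing is changed, or the left side is zero and one factor on the
  right is zero.\<close>

lemma proj_bracket:
  assumes x: "x \<in> carrier L" and y: "y \<in> carrier L"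
  shows "proj (br x y) = br (proj x) (proj y)"
proof (rule graded_hom_eqI[OF module_axioms module_hom_comp[OF bracket_hom_left[OF y] proj_hom]
      module_hom_comp[OF proj_hom bracket_hom_left[OF proj_closed[OF y]]] _ x])
  fix m x assume x: "x \<in> G m"
  show "proj (br x y) = br (proj x) (proj y)"
  proof (rule graded_hom_eqI[OF module_axioms module_hom_comp[OF bracket_hom_right[OF degree_carrier[OF x]] proj_hom]
        module_hom_comp[OF proj_hom bracket_hom_right[OF proj_closed[OF degree_carrier[OF x]]]] _ y])
    fix n y assume y: "y \<in> G n"
    show "proj (br x y) = br (proj x) (proj y)"
      using proj_homogeneous[OF bracket_graded[OF x y]] proj_homogeneous[OF x] proj_homogeneous[OF y]
        module_hom_zero[OF module_axioms module_axioms bracket_hom_left]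
        module_hom_zero[OF module_axioms module_axioms bracket_hom_right]
        degree_carrier[OF x] degree_carrier[OF y] by auto
  qed
qed

lemma degree_0_lie_algebra: "lie_algebra R L0"
proof (intro lie_algebra.intro lie_algebra_axioms.intro)
  show "module R L0" by (rule submodule.submodule_is_module[OF degree_submodule module_axioms])
qed (use bracket_graded[of _ 0 _ 0] degree_carrier[of _ 0] in
    \<open>auto simp: bracket_add_left bracket_add_right bracket_smult_left bracket_smult_right bracket_self jacobi\<close>)

lemma inclusion_lie_hom: "lie_hom R L0 L (\<lambda>x. x)"
  by (intro lie_hom.intro lie_hom_axioms.intro degree_0_lie_algebra lie_algebra_axioms)
    (auto simp: module_hom_def degree_carrier)

lemma proj_lie_hom: "lie_hom R L L0 proj"
  by (intro lie_hom.intro lie_hom_axioms.intro degree_0_lie_algebra lie_algebra_axioms)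
    (use proj_hom in \<open>auto simp: module_hom_def proj_degree_0 proj_bracket\<close>)

interpretation incl: lie_hom R L0 L "\<lambda>x. x" by (rule inclusion_lie_hom)
interpretation pr: lie_hom R L L0 proj by (rule proj_lie_hom)

lemma ext_proj_incl:
  assumes "z \<in> carrier (ext_power R L0 3)"
  shows "ext_power_map R L0 3 proj (ext_power_map R L 3 (\<lambda>x. x) z) = z"
proof (rule incl.src.E3.ext_hom_eqI[OF incl.src.ME3.module_axioms module_hom_comp[OF incl.ext_hom pr.ext_hom] module_hom_id _ assms])
  fix xs assume "xs \<in> tuples L0 3"
  then obtain x y z where xs: "xs = [x, y, z]" and G: "x \<in> G 0" "y \<in> G 0" "z \<in> G 0"
    by (auto elim: tuples_3E)
  then show "ext_power_map R L0 3 proj (ext_power_map R L 3 (\<lambda>x. x) (wedge R L0 xs)) = wedge R L0 xs"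
    by (simp add: incl.ext_wedge_3 pr.ext_wedge_3 degree_carrier proj_homogeneous)
qed

text \<open>Natural numbers with sum 0 are all 0, so every generator of the degree 0 part has its
  entries in \<open>G 0\<close>, where \<open>proj\<close> is the identity.\<close>

lemma ext_incl_proj:
  assumes "z \<in> ext_power_degree R L G 3 0"
  shows "ext_power_map R L 3 (\<lambda>x. x) (ext_power_map R L0 3 proj z) = z"
  by (rule ext_degree_hom_eqI[OF ME3.module_axioms module_hom_comp[OF pr.ext_hom incl.ext_hom] module_hom_id _ assms])
    (simp add: incl.ext_wedge_3 pr.ext_wedge_3 degree_carrier proj_homogeneous)

lemma ext_incl_degree:
  assumes "z \<in> carrier (ext_power R L0 3)"
  shows "ext_power_map R L 3 (\<lambda>x. x) z \<in> ext_power_degree R L G 3 0"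
proof -
  let ?H = "{z \<in> carrier (ext_power R L0 3). ext_power_map R L 3 (\<lambda>x. x) z \<in> ext_power_degree R L G 3 0}"
  have "module_span R (ext_power R L0 3) (wedge R L0 ` tuples L0 3) \<subseteq> ?H"
  proof (rule module_span_minimal)
    show "submodule ?H R (ext_power R L0 3)"
      by (rule submodule_vimage[OF incl.src.ME3.module_axioms ME3.module_axioms incl.ext_hom ext_degree_submodule])
    show "wedge R L0 ` tuples L0 3 \<subseteq> ?H"
    proof (intro image_subsetI CollectI conjI incl.src.E3.wedge_closed)
      fix xs assume "xs \<in> tuples L0 3"
      then obtain x y z where xs: "xs = [x, y, z]" and G: "x \<in> G 0" "y \<in> G 0" "z \<in> G 0"
        by (auto elim: tuples_3E)
      \<comment> \<open>The list of zeros is the witness for the degrees in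
        \<open>ext_power_degree\<close>.\<close>
      have "list_all2 (\<lambda>x d. x \<in> G d) [x, y, z] [0, 0, 0]" "sum_list [0, 0, 0 :: nat] = 0" "length [x, y, z] = 3"
        using G by simp_all
      then have "w3 x y z \<in> ext_power_degree R L G 3 0"
        unfolding ext_power_degree_def by (intro subsetD[OF module_span_superset]) blast
      then show "ext_power_map R L 3 (\<lambda>x. x) (wedge R L0 xs) \<in> ext_power_degree R L G 3 0"
        using G by (simp add: xs incl.ext_wedge_3)
    qed
  qed
  then show ?thesis using assms incl.src.E3.wedge_span by blast
qed

text \<open>A cycle of \<open>L0\<close> might bound in \<open>L\<close> through chains of positive
  degree; the projection carries such a chain back to \<open>L0\<close>, which gives injectivity. A
  cycle of degree 0 in \<open>L\<close> is the image of its projection, again a cycle, which gives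
  surjectivity.\<close>

lemma homology_degree_0_iso:
  "ce_homology_map R L 3 (\<lambda>x. x) \<in> module_iso R (ce_homology R L0 3)
    ((ce_homology R L 3)\<lparr>carrier := ce_homology_degree R L G 3 0\<rparr>)"
proof -
  let ?h = "ce_homology_map R L 3 (\<lambda>x. x)" and ?p = "ce_homology_map R L0 3 proj"
  have hc: "?h c \<in> ce_homology_degree R L G 3 0" "?p (?h c) = c" if c: "c \<in> carrier (ce_homology R L0 3)" for c
  proof -
    obtain z where z: "z \<in> ce_cycles R L0 3" "c = homology_class R L0 3 z"
      using c by (auto simp: incl.src.homology_carrier)
    have "z \<in> carrier (ext_power R L0 3)" using z(1) by (simp add: incl.src.mem_cycles)
    with z show "?h c \<in> ce_homology_degree R L G 3 0" "?p (?h c) = c"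
      by (auto simp: ce_homology_degree_def incl.homology_map_class pr.homology_map_class
          incl.cycles_map ext_incl_degree ext_proj_incl)
  qed
  have "c \<in> ?h ` carrier (ce_homology R L0 3)" if c: "c \<in> ce_homology_degree R L G 3 0" for c
  proof -
    obtain z where z: "z \<in> ce_cycles R L 3" "z \<in> ext_power_degree R L G 3 0" "c = homology_class R L 3 z"
      using c by (auto simp: ce_homology_degree_def)
    then have "c = ?h (homology_class R L0 3 (ext_power_map R L0 3 proj z))"
      by (simp add: incl.homology_map_class pr.cycles_map ext_incl_proj)
    then show ?thesis using z pr.cycles_map by (auto simp: incl.src.homology_carrier)
  qed
  then have "bij_betw ?h (carrier (ce_homology R L0 3)) (ce_homology_degree R L G 3 0)"
    using hc by (intro bij_betw_imageI inj_on_inverseI[where g = ?p]) auto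
  then show ?thesis
    using incl.homology_map_hom hc by (auto simp: module_iso_def module_hom_def)
qed

section \<open>The degree zero part of the Killing module\<close>

lemma sym_degree_carrier: "{sym_prod R L x y | x y i j. x \<in> G i \<and> y \<in> G j \<and> i + j = n} \<subseteq> carrier S.S"
  by (auto intro!: S.sym_prod_closed degree_carrier)

lemma sym_degree_submodule: "submodule (sym_square_degree R L G n) R S.S"
  unfolding sym_square_degree_def by (intro module_span_submodule MS.module_axioms sym_degree_carrier)

lemma sym_proj_incl:
  assumes "s \<in> carrier (sym_square R L0)"
  shows "sym_square_map R L0 proj (sym_square_map R L (\<lambda>x. x) s) = s"
  by (rule incl.src.S.sym_hom_eqI[OF incl.src.MS.module_axioms module_hom_comp[OF incl.sym_hom pr.sym_hom] module_hom_id _ assms])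
    (simp add: incl.sym_prod pr.sym_prod degree_carrier proj_homogeneous)

lemma sym_incl_proj:
  assumes "s \<in> sym_square_degree R L G 0"
  shows "sym_square_map R L (\<lambda>x. x) (sym_square_map R L0 proj s) = s"
  by (rule module_hom_eq_on_span[OF MS.module_axioms MS.module_axioms module_hom_comp[OF pr.sym_hom incl.sym_hom] module_hom_id
        sym_degree_carrier _ assms[unfolded sym_square_degree_def]])
    (auto simp: incl.sym_prod pr.sym_prod degree_carrier proj_homogeneous)

lemma sym_incl_degree:
  assumes "s \<in> carrier (sym_square R L0)"
  shows "sym_square_map R L (\<lambda>x. x) s \<in> sym_square_degree R L G 0"
proof -
  let ?H = "{s \<in> carrier (sym_square R L0). sym_square_map R L (\<lambda>x. x) s \<in> sym_square_degree R L G 0}"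
  have "submodule ?H R (sym_square R L0)"
    by (rule submodule_vimage[OF incl.src.MS.module_axioms MS.module_axioms incl.sym_hom sym_degree_submodule])
  moreover have "sym_prod R L x y \<in> sym_square_degree R L G 0" if "x \<in> G 0" "y \<in> G 0" for x y
    unfolding sym_square_degree_def
    by (rule subsetD[OF module_span_superset]) (use that in force)
  ultimately have "module_span R (sym_square R L0) {sym_prod R L0 x y | x y. x \<in> carrier L0 \<and> y \<in> carrier L0} \<subseteq> ?H"
    by (intro module_span_minimal) (auto simp: incl.sym_prod intro!: incl.src.S.sym_prod_closed)
  then show ?thesis using assms incl.src.S.sym_prod_span by blast
qed

text \<open>Relations in \<open>L\<close> involving positive degrees are carried by the projection
  to relations in \<open>L0\<close>, so no further classes of \<open>L0\<close> are killed.
  Representatives of degree 0 are recovered from their projections.\<close>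

lemma kill_degree_0_iso:
  "kill_map R L (\<lambda>x. x) \<in> module_iso R (kill R L0) ((kill R L)\<lparr>carrier := kill_degree R L G 0\<rparr>)"
proof -
  let ?k = "kill_map R L (\<lambda>x. x)" and ?p = "kill_map R L0 proj"
  have kc: "?k c \<in> kill_degree R L G 0" "?p (?k c) = c" if c: "c \<in> carrier (kill R L0)" for c
  proof -
    obtain s where s: "s \<in> carrier (sym_square R L0)" "c = kill_class R L0 s"
      using c by (auto simp: incl.src.kill_carrier)
    then show "?k c \<in> kill_degree R L G 0" "?p (?k c) = c"
      using module_hom_closed[OF incl.sym_hom s(1)]
      by (auto simp: kill_degree_def incl.kill_map_class pr.kill_map_class sym_incl_degree sym_proj_incl)
  qed
  have "c \<in> ?k ` carrier (kill R L0)" if c: "c \<in> kill_degree R L G 0" for c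
  proof -
    obtain s where s: "s \<in> sym_square_degree R L G 0" "c = kill_class R L s"
      using c by (auto simp: kill_degree_def)
    then have s': "sym_square_map R L0 proj s \<in> carrier (sym_square R L0)"
      using module_hom_closed[OF pr.sym_hom] submodule_carrier[OF sym_degree_submodule] by blast
    then have "c = ?k (kill_class R L0 (sym_square_map R L0 proj s))"
      using s by (simp add: incl.kill_map_class sym_incl_proj)
    then show ?thesis using s' by (auto simp: incl.src.kill_carrier)
  qed
  then have "bij_betw ?k (carrier (kill R L0)) (kill_degree R L G 0)"
    using kc by (intro bij_betw_imageI inj_on_inverseI[where g = ?p]) auto
  then show ?thesis
    using incl.kill_map_hom kc by (auto simp: module_iso_def module_hom_def)
qed

lemmas reduced_koszul_incl = incl.reduced_koszul_natural

end

theorem corollary1p4: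
  fixes R :: "(rat, 'a) module"
    and L :: "('a, 'b) lie"
    and G :: "nat \<Rightarrow> 'b set"
  assumes "algebra (ring_of_type_algebra :: rat ring) R"
    and "graded_lie_algebra R L G"
  shows "(\<forall>n. n \<noteq> 0 \<longrightarrow>
            (\<forall>c\<in>ce_homology_degree R L G 3 n. reduced_koszul R L c = \<zero>\<^bsub>kill R L\<^esub>)) \<and>
         (let L0 = L\<lparr>carrier := G 0\<rparr>;
              h = ce_homology_map R L 3 (\<lambda>x. x);
              k = kill_map R L (\<lambda>x. x)
          in h \<in> module_iso R (ce_homology R L0 3)
                   ((ce_homology R L 3)\<lparr>carrier := ce_homology_degree R L G 3 0\<rparr>) \<and>
             k \<in> module_iso R (kill R L0) ((kill R L)\<lparr>carrier := kill_degree R L G 0\<rparr>) \<and>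
             (\<forall>c\<in>carrier (ce_homology R L0 3).
                reduced_koszul R L (h c) = k (reduced_koszul R L0 c)))"
proof -
  \<comment> \<open>\<open>R\<close> has two roles: it is an algebra over the rationals, with its
    own scalar action, and the ground ring of \<open>L\<close>.\<close>
  interpret Q: algebra "ring_of_type_algebra :: rat ring" R by fact
  interpret graded_lie_algebra R L G by fact
  have Q: "carrier ring_of_type_algebra = (UNIV :: rat set)" "x \<oplus>\<^bsub>ring_of_type_algebra\<^esub> y = x + y"
    "x \<otimes>\<^bsub>ring_of_type_algebra\<^esub> y = x * y" "\<one>\<^bsub>ring_of_type_algebra\<^esub> = (1 :: rat)" for x y :: rat
    by (simp_all add: ring_of_type_algebra_def)
  \<comment> \<open>The degree n becomes the scalar n times the unit of \<open>R\<close>, through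
    the rational action; distributivity of that action gives additivity.\<close>
  let ?\<nu> = "\<lambda>n :: nat. of_nat n \<odot>\<^bsub>R\<^esub> \<one>\<^bsub>R\<^esub>"
  have closed: "a \<odot>\<^bsub>R\<^esub> \<one>\<^bsub>R\<^esub> \<in> carrier R" for a
    by (rule Q.smult_closed) (simp_all add: Q)
  have add: "?\<nu> (m + n) = ?\<nu> m \<oplus>\<^bsub>R\<^esub> ?\<nu> n" for m n
    using Q.smult_l_distr[of "of_nat m" "of_nat n" "\<one>\<^bsub>R\<^esub>"] by (simp add: Q)
  \<comment> \<open>The rational 1/n acting on the unit is the inverse of n times the unit. This is
    where characteristic zero and a nonzero degree enter.\<close>
  have inverse: "((1 / of_nat n) \<odot>\<^bsub>R\<^esub> \<one>\<^bsub>R\<^esub>) \<otimes>\<^bsub>R\<^esub> ?\<nu> n = \<one>\<^bsub>R\<^esub>" if "n \<noteq> 0" for n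
  proof -
    have "((1 / of_nat n) \<odot>\<^bsub>R\<^esub> \<one>\<^bsub>R\<^esub>) \<otimes>\<^bsub>R\<^esub> ?\<nu> n = (1 / of_nat n * of_nat n) \<odot>\<^bsub>R\<^esub> \<one>\<^bsub>R\<^esub>"
      using Q.smult_assoc2[of "1 / of_nat n" "\<one>\<^bsub>R\<^esub>" "?\<nu> n"] Q.smult_assoc1[of "1 / of_nat n" "of_nat n" "\<one>\<^bsub>R\<^esub>"]
        closed[of "of_nat n"] by (simp add: Q)
    then show ?thesis using that Q.smult_one[of "\<one>\<^bsub>R\<^esub>"] by (simp add: Q)
  qed
  have "reduced_koszul R L c = \<zero>\<^bsub>kill R L\<^esub>" if "n \<noteq> 0" "c \<in> ce_homology_degree R L G 3 n" for n c
    using reduced_koszul_vanishes[OF closed add closed inverse[OF that(1)] that(2)] .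
  then show ?thesis
    using homology_degree_0_iso kill_degree_0_iso reduced_koszul_incl by (simp add: Let_def)
qed

end
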